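(* Let $F(x)=\psi(x)+f(x)$ with $f(x)=\frac1n\sum_{i=1}^nf_i(x)$, $x\in\mathbb R^d$, where $\psi$ is proper convex, each $f_i$ is possibly nonconvex but $L$-smooth, $f$ is $\sigma$-nonconvex for some $\sigma\in(0,L]$, and $\mathbb E_{i\in_R[n]}\|\nabla f(x)-\nabla f_i(x)\|^2\le\mathcal V$ for every $x$ with $\psi(x)<+\infty$. Let $x^\varnothing$ be a starting vector, $\Delta_F$ an upper bound on $F(x^\varnothing)-\min_x\{F(x)\}$, and $\eta=\frac CL$ where $C\in(0,1]$ is any absolute constant. Let $\varepsilon>0$; if $\sigma$ is too small to satisfy $\sigma\ge\Omega\big(\frac{\varepsilon L}{\mathcal V^{1/2}}\big)$, replace it by $\Theta\big(\frac{\varepsilon L}{\mathcal V^{1/2}}\big)$, so that the parameter $\sigma$ used by the algorithm satisfies $L\ge\sigma\ge\Omega\big(\frac{\varepsilon L}{\mathcal V^{1/2}}\big)$. Then the algorithm $\mathrm{Natasha1.5^{prune}}(F,x^\varnothing,\varepsilon)$ described in the context computes an output $x^{\mathsf{out}}$ with $\mathbb E[\|\mathcal G_{F,\eta}(x^{\mathsf{out}})\|]\le\varepsilon$ and, treating $L$, $\Delta_F$ and $\mathcal V$ as constants, its gradient complexity is $$T=O\Big(\frac1{\varepsilon^3}+\frac{\sigma^{1/3}}{\varepsilon^{10/3}}\Big),$$ where $\sigma$ in this bound is the original nonconvexity parameter of $f$.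
   Context: $\|\cdot\|$ is the Euclidean norm; $i\in_R[n]$ means $i$ is uniform on $[n]=\{1,\dots,n\}$. A function $f$ is $L$-smooth if $\|\nabla f(x)-\nabla f(y)\|\le L\|x-y\|$ for all $x,y$; a differentiable $f$ is $\sigma$-nonconvex if $f(y)\ge f(x)+\langle\nabla f(x),y-x\rangle-\frac\sigma2\|x-y\|^2$ for all $x,y$. For $H=\psi+h$, the gradient mapping is $\mathcal G_{H,\eta}(x)=\frac1\eta(x-x')$ with $x'=\arg\min_y\{\psi(y)+\langle\nabla h(x),y\rangle+\frac1{2\eta}\|y-x\|^2\}$. Gradient complexity is the number of computations of $\nabla f_i(x)$. Algorithm $\mathrm{Natasha1.5^{full}}(F,x^\varnothing,B,p,T',\alpha)$, with epoch length $B\in[n]$, sub-epoch count $p\in[B]$, epoch count $T'\ge1$ and learning rate $\alpha>0$: set $\widehat x\leftarrow x^\varnothing$, $m\leftarrow B/p$, and let $X$ be an empty list. Repeat for $T'$ epochs: set $\widetilde x\leftarrow\widehat x$ and $\mu\leftarrow\frac1B\sum_{i\in S}\nabla f_i(\widetilde x)$ with $S$ a uniform random subset of $[n]$ of size $B$; then, for each of $p$ sub-epochs, set $x_0\leftarrow\widehat x$, append $\widehat x$ to $X$, for $t=0,\dots,m-1$ draw a fresh $i\in_R[n]$, set $\widetilde\nabla\leftarrow\nabla f_i(x_t)-\nabla f_i(\widetilde x)+\mu+2\sigma(x_t-\widehat x)$ and $x_{t+1}=\arg\min_{y\in\mathbb R^d}\{\psi(y)+\frac1{2\alpha}\|y-x_t\|^2+\langle\widetilde\nabla,y\rangle\}$,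 and at the end of the sub-epoch let $\widehat x$ be a random choice from $\{x_0,\dots,x_{m-1}\}$. Return $(\widehat y,y^+)$, where $\widehat y$ is a random vector in $X$ and $y^+$ is the final $\widehat x$. Subroutine $\mathrm{SGD3^{sc}}(G,x_0,\sigma,L,T)$: a variant of stochastic gradient descent for $G=\psi+g$, $g=\frac1n\sum_ig_i$, where $\psi$ is proper convex, each $g_i$ is differentiable, $g$ is convex and $L$-smooth, $G$ is $\sigma$-strongly convex with minimizer $x^*$, and the stochastic gradients $\nabla g_i$ have variance at most $\mathcal V$ over the domain of $\psi$. For every $T\ge\frac L\sigma\log\frac L\sigma$ it computes $T$ stochastic gradients and outputs $\overline x$ with $\mathbb E[\|\mathcal G_{G,\eta}(\overline x)\|]\le O\big(\frac{\sqrt{\mathcal V}\log^{3/2}(L/\sigma)}{\sqrt T}\big)+\big(1-\frac\sigma L\big)^{\Omega(T/\log(L/\sigma))}\sigma\|x_0-x^*\|$, $\eta=C/L$. Algorithm $\mathrm{Natasha1.5^{prune}}(F,x^\varnothing,\varepsilon)$: set $B\leftarrow\Theta(\frac{\mathcal V}{\varepsilon^2})$, $p\leftarrow(\frac{\sigma^2}{48L^2}B)^{1/3}$, $\alpha\leftarrow\Theta(\frac\sigma{p^2L^2})$; let $T_0=\Theta\big(\frac{(L^2\sigma)^{1/3}\Delta_F\mathcal V^{2/3}}{\varepsilon^{10/3}}\big)$ and $(\widehat y,y^+)\leftarrow\mathrm{Natasha1.5^{full}}(F,x^\varnothing,B,p,T_0/B,\alpha)$; define the convex function $G(x)=F(x)+\sigma\|x-\widehat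 y\|^2$; return $x^{\mathsf{out}}\leftarrow\mathrm{SGD3^{sc}}(G,\widehat y,\sigma,O(L),T_{\mathrm{sgd}})$ with $T_{\mathrm{sgd}}=\Theta\big(\frac{\mathcal V}{\varepsilon^2}\log^3\frac L\sigma\big)$. *)

theory Defs
  imports "HOL-Probability.Probability"
begin

definition grad :: "('a::euclidean_space \<Rightarrow> real) \<Rightarrow> 'a \<Rightarrow> 'a" where
  "grad f x = (THE D. GDERIV f x :> D)"

definition smooth :: "real \<Rightarrow> ('a::euclidean_space \<Rightarrow> real) \<Rightarrow> bool" where
  "smooth L f \<longleftrightarrow> (\<forall>x. f differentiable (at x)) \<and>
     (\<forall>x y. norm (grad f x - grad f y) \<le> L * norm (x - y))"

definition nonconvex :: "real \<Rightarrow> ('a::euclidean_space \<Rightarrow> real) \<Rightarrow> bool" where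
  "nonconvex \<sigma> f \<longleftrightarrow> (\<forall>x. f differentiable (at x)) \<and>
     (\<forall>x y. f y \<ge> f x + grad f x \<bullet> (y - x) - \<sigma> / 2 * (norm (x - y))\<^sup>2)"

definition strongly_convex :: "real \<Rightarrow> ('a::euclidean_space \<Rightarrow> ereal) \<Rightarrow> bool" where
  "strongly_convex \<sigma> H \<longleftrightarrow> (\<forall>x y. \<forall>t\<in>{0<..<1}.
     H ((1 - t) *\<^sub>R x + t *\<^sub>R y)
       \<le> ereal (1 - t) * H x + ereal t * H y - ereal (\<sigma> / 2 * t * (1 - t) * (norm (x - y))\<^sup>2))"

definition proper_convex :: "('a::euclidean_space \<Rightarrow> ereal) \<Rightarrow> bool" where
  "proper_convex \<psi> \<longleftrightarrow> (\<forall>x. \<psi> x \<noteq> -\<infinity>) \<and> (\<exists>x. \<psi> x \<noteq> \<infinity>) \<and>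
     (\<forall>x y. \<forall>t\<in>{0<..<1}. \<psi> ((1 - t) *\<^sub>R x + t *\<^sub>R y) \<le> ereal (1 - t) * \<psi> x + ereal t * \<psi> y)"

definition prox_objective :: "('a::euclidean_space \<Rightarrow> ereal) \<Rightarrow> real \<Rightarrow> 'a \<Rightarrow> 'a \<Rightarrow> 'a \<Rightarrow> ereal" where
  "prox_objective \<psi> \<eta> v x y = \<psi> y + ereal (v \<bullet> y + (norm (y - x))\<^sup>2 / (2 * \<eta>))"

definition prox_step :: "('a::euclidean_space \<Rightarrow> ereal) \<Rightarrow> real \<Rightarrow> 'a \<Rightarrow> 'a \<Rightarrow> 'a" where
  "prox_step \<psi> \<eta> v x = arg_min (prox_objective \<psi> \<eta> v x) (\<lambda>_. True)"

text \<open>The minima defining the algorithms and the gradient mapping are attained.  For proper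
  convex \<open>\<psi>\<close> this follows from lower semicontinuity, but may fail otherwise (take the
  indicator of an open ball).\<close>

definition prox_attained :: "('a::euclidean_space \<Rightarrow> ereal) \<Rightarrow> bool" where
  "prox_attained \<psi> \<longleftrightarrow> (\<forall>\<eta>>0. \<forall>v x. \<exists>y. is_arg_min (prox_objective \<psi> \<eta> v x) (\<lambda>_. True) y)"

definition gradient_mapping ::
  "('a::euclidean_space \<Rightarrow> ereal) \<Rightarrow> ('a \<Rightarrow> real) \<Rightarrow> real \<Rightarrow> 'a \<Rightarrow> 'a" where
  "gradient_mapping \<psi> h \<eta> x = (1 / \<eta>) *\<^sub>R (x - prox_step \<psi> \<eta> (grad h x) x)"

definition average :: "nat \<Rightarrow> (nat \<Rightarrow> 'a::euclidean_space \<Rightarrow> real) \<Rightarrow> 'a \<Rightarrow> real" where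
  "average n fs x = (\<Sum>i=1..n. fs i x) / real n"

definition composite ::
  "nat \<Rightarrow> (nat \<Rightarrow> 'a::euclidean_space \<Rightarrow> real) \<Rightarrow> ('a \<Rightarrow> ereal) \<Rightarrow> 'a \<Rightarrow> ereal" where
  "composite n fs \<psi> x = \<psi> x + ereal (average n fs x)"

definition gradient_variance :: "nat \<Rightarrow> (nat \<Rightarrow> 'a::euclidean_space \<Rightarrow> real) \<Rightarrow> 'a \<Rightarrow> real" where
  "gradient_variance n fs x =
     measure_pmf.expectation (pmf_of_set {1..n})
       (\<lambda>i. (norm (grad (average n fs) x - grad (fs i) x))\<^sup>2)"

definition variance_at_most ::
  "real \<Rightarrow> nat \<Rightarrow> (nat \<Rightarrow> 'a::euclidean_space \<Rightarrow> real) \<Rightarrow> ('a \<Rightarrow> ereal) \<Rightarrow> bool" where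
  "variance_at_most V n fs \<psi> \<longleftrightarrow> (\<forall>x. \<psi> x < \<infinity> \<longrightarrow> gradient_variance n fs x \<le> V)"

text \<open>A run of an algorithm is a distribution on pairs: the result, and the number of gradients of
  component functions computed to obtain it.\<close>

type_synonym 'r run = "('r \<times> nat) pmf"

text \<open>Uniform over positions, so a vector that occurs repeatedly is chosen proportionally often.\<close>

definition uniform_entry :: "'b list \<Rightarrow> 'b pmf" where
  "uniform_entry xs = map_pmf (\<lambda>j. xs ! j) (pmf_of_set {..<length xs})"

definition natasha_step ::
  "(nat \<Rightarrow> 'a::euclidean_space \<Rightarrow> real) \<Rightarrow> ('a \<Rightarrow> ereal) \<Rightarrow> real \<Rightarrow> real \<Rightarrow> 'a \<Rightarrow> 'a \<Rightarrow> 'a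
    \<Rightarrow> nat \<Rightarrow> 'a \<Rightarrow> 'a" where
  "natasha_step fs \<psi> \<sigma> \<alpha> xtilde \<mu> xhat i x =
     prox_step \<psi> \<alpha> (grad (fs i) x - grad (fs i) xtilde + \<mu> + (2 * \<sigma>) *\<^sub>R (x - xhat)) x"

text \<open>With \<open>k = m\<close> steps, the result is the list of \<open>x\<^sub>0\<close> up to \<open>x\<close> with index \<open>m - 1\<close>; the last
  iterate is computed, and paid for, but not recorded.\<close>

primrec inner_loop ::
  "nat \<Rightarrow> (nat \<Rightarrow> 'a::euclidean_space \<Rightarrow> real) \<Rightarrow> ('a \<Rightarrow> ereal) \<Rightarrow> real \<Rightarrow> real \<Rightarrow> 'a \<Rightarrow> 'a \<Rightarrow> 'a
    \<Rightarrow> nat \<Rightarrow> 'a \<Rightarrow> 'a list run" where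
  "inner_loop n fs \<psi> \<sigma> \<alpha> xtilde \<mu> xhat 0 x = return_pmf ([], 0)"
| "inner_loop n fs \<psi> \<sigma> \<alpha> xtilde \<mu> xhat (Suc k) x = do {
     i \<leftarrow> pmf_of_set {1..n};
     (xs, c) \<leftarrow> inner_loop n fs \<psi> \<sigma> \<alpha> xtilde \<mu> xhat k (natasha_step fs \<psi> \<sigma> \<alpha> xtilde \<mu> xhat i x);
     return_pmf (x # xs, 2 + c)
   }"

text \<open>The result of \<open>sub_epochs\<close> and \<open>epochs\<close> is the list of vectors appended to \<open>X\<close>, together
  with the last \<open>xhat\<close>.\<close>

primrec sub_epochs ::
  "nat \<Rightarrow> (nat \<Rightarrow> 'a::euclidean_space \<Rightarrow> real) \<Rightarrow> ('a \<Rightarrow> ereal) \<Rightarrow> real \<Rightarrow> real \<Rightarrow> nat \<Rightarrow> 'a \<Rightarrow> 'a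
    \<Rightarrow> nat \<Rightarrow> 'a \<Rightarrow> ('a list \<times> 'a) run" where
  "sub_epochs n fs \<psi> \<sigma> \<alpha> m xtilde \<mu> 0 xhat = return_pmf (([], xhat), 0)"
| "sub_epochs n fs \<psi> \<sigma> \<alpha> m xtilde \<mu> (Suc k) xhat = do {
     (xs, c) \<leftarrow> inner_loop n fs \<psi> \<sigma> \<alpha> xtilde \<mu> xhat m xhat;
     xhat' \<leftarrow> uniform_entry xs;
     ((X, y), c') \<leftarrow> sub_epochs n fs \<psi> \<sigma> \<alpha> m xtilde \<mu> k xhat';
     return_pmf ((xhat # X, y), c + c')
   }"

primrec epochs ::
  "nat \<Rightarrow> (nat \<Rightarrow> 'a::euclidean_space \<Rightarrow> real) \<Rightarrow> ('a \<Rightarrow> ereal) \<Rightarrow> real \<Rightarrow> nat \<Rightarrow> nat \<Rightarrow> real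
    \<Rightarrow> nat \<Rightarrow> 'a \<Rightarrow> ('a list \<times> 'a) run" where
  "epochs n fs \<psi> \<sigma> B p \<alpha> 0 xhat = return_pmf (([], xhat), 0)"
| "epochs n fs \<psi> \<sigma> B p \<alpha> (Suc k) xhat = do {
     S \<leftarrow> pmf_of_set {S. S \<subseteq> {1..n} \<and> card S = B};
     let \<mu> = (1 / real B) *\<^sub>R (\<Sum>i\<in>S. grad (fs i) xhat);
     ((X, y), c) \<leftarrow> sub_epochs n fs \<psi> \<sigma> \<alpha> (B div p) xhat \<mu> p xhat;
     ((X', z), c') \<leftarrow> epochs n fs \<psi> \<sigma> B p \<alpha> k y;
     return_pmf ((X @ X', z), B + c + c')
   }"

definition natasha_full ::
  "nat \<Rightarrow> (nat \<Rightarrow> 'a::euclidean_space \<Rightarrow> real) \<Rightarrow> ('a \<Rightarrow> ereal) \<Rightarrow> real \<Rightarrow> 'a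
    \<Rightarrow> nat \<Rightarrow> nat \<Rightarrow> nat \<Rightarrow> real \<Rightarrow> ('a \<times> 'a) run" where
  "natasha_full n fs \<psi> \<sigma> x0 B p T' \<alpha> = do {
     ((X, yplus), c) \<leftarrow> epochs n fs \<psi> \<sigma> B p \<alpha> T' x0;
     yhat \<leftarrow> uniform_entry X;
     return_pmf ((yhat, yplus), c)
   }"

text \<open>The arguments of a subroutine are the number of components, the components \<open>g\<^sub>i\<close>, the
  function \<open>\<psi>\<close>, the starting vector, \<open>\<sigma>\<close>, \<open>L\<close> and \<open>T\<close>.\<close>

type_synonym 'a subroutine =
  "nat \<Rightarrow> (nat \<Rightarrow> 'a \<Rightarrow> real) \<Rightarrow> ('a \<Rightarrow> ereal) \<Rightarrow> 'a \<Rightarrow> real \<Rightarrow> real \<Rightarrow> nat \<Rightarrow> 'a run"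

text \<open>The reals \<open>c1\<close> and \<open>c2\<close> are the constants hidden in \<open>O\<close> and \<open>\<Omega>\<close> of the guarantee.  The
  guarantee is required only for \<open>3 * \<sigma> \<le> L\<close>: it degenerates as \<open>L / \<sigma>\<close> tends to 1, where it would
  bound the gradient mapping by 0.  It is also required only for starting vectors in the domain of
  \<open>\<psi>\<close>, since outside of it the variance of the stochastic gradients is not controlled.\<close>

definition sgd3_sc ::
  "real \<Rightarrow> real \<Rightarrow> real \<Rightarrow> 'a::euclidean_space subroutine \<Rightarrow> bool" where
  "sgd3_sc C c1 c2 sgd \<longleftrightarrow> (\<forall>n g \<psi> x0 xstar \<sigma> L V T.
     n \<ge> 1 \<longrightarrow> proper_convex \<psi> \<longrightarrow> prox_attained \<psi> \<longrightarrow>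
     (\<forall>i\<in>{1..n}. \<forall>x. g i differentiable (at x)) \<longrightarrow>
     convex_on UNIV (average n g) \<longrightarrow> smooth L (average n g) \<longrightarrow>
     strongly_convex \<sigma> (composite n g \<psi>) \<longrightarrow> 0 < \<sigma> \<longrightarrow> 3 * \<sigma> \<le> L \<longrightarrow>
     variance_at_most V n g \<psi> \<longrightarrow> \<psi> x0 < \<infinity> \<longrightarrow>
     is_arg_min (composite n g \<psi>) (\<lambda>_. True) xstar \<longrightarrow>
     real T \<ge> L / \<sigma> * ln (L / \<sigma>) \<longrightarrow>
     (\<forall>(x, k) \<in> set_pmf (sgd n g \<psi> x0 \<sigma> L T). k = T) \<and>
     integrable (measure_pmf (sgd n g \<psi> x0 \<sigma> L T))
       (\<lambda>(x, k). norm (gradient_mapping \<psi> (average n g) (C / L) x)) \<and>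
     measure_pmf.expectation (sgd n g \<psi> x0 \<sigma> L T)
       (\<lambda>(x, k). norm (gradient_mapping \<psi> (average n g) (C / L) x))
     \<le> c1 * (sqrt V * ln (L / \<sigma>) powr (3/2) / sqrt (real T))
        + (1 - \<sigma> / L) powr (c2 * (real T / ln (L / \<sigma>))) * \<sigma> * norm (x0 - xstar))"

text \<open>All constants hidden in \<open>\<Theta>\<close> and \<open>\<Omega>\<close> are fixed to numerals below (and in \<open>sgd_length\<close> to
  a function of the constant \<open>c1\<close> of the subroutine), so they depend neither on the dimension nor
  on the problem.  Integer parameters are rounded.\<close>

definition sigma_used :: "real \<Rightarrow> real \<Rightarrow> real \<Rightarrow> real \<Rightarrow> real" where
  "sigma_used L V \<epsilon> \<sigma> = max \<sigma> (\<epsilon> * L / sqrt V)"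

definition epoch_length :: "real \<Rightarrow> real \<Rightarrow> nat" where
  "epoch_length V \<epsilon> = nat \<lceil>10^4 * V / \<epsilon>\<^sup>2\<rceil>"

definition sub_epoch_count :: "real \<Rightarrow> real \<Rightarrow> nat \<Rightarrow> nat" where
  "sub_epoch_count L \<sigma> B = nat \<lfloor>(\<sigma>\<^sup>2 / (48 * L\<^sup>2) * real B) powr (1/3)\<rfloor>"

definition learning_rate :: "real \<Rightarrow> real \<Rightarrow> nat \<Rightarrow> real" where
  "learning_rate L \<sigma> p = (1/6) * (\<sigma> / ((real p)\<^sup>2 * L\<^sup>2))"

definition natasha_length :: "real \<Rightarrow> real \<Rightarrow> real \<Rightarrow> real \<Rightarrow> real \<Rightarrow> real" where
  "natasha_length L V \<Delta> \<epsilon> \<sigma> =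
     10^8 * ((L\<^sup>2 * \<sigma>) powr (1/3) * \<Delta> * V powr (2/3) / \<epsilon> powr (10/3))"

definition epoch_count :: "real \<Rightarrow> nat \<Rightarrow> nat" where
  "epoch_count T0 B = max 1 (nat \<lceil>T0 / real B\<rceil>)"

text \<open>The subroutine is called with smoothness parameter \<open>3 * L\<close>, which is therefore also the
  one inside the logarithm; it keeps the logarithm positive when \<open>\<sigma> = L\<close>.\<close>

definition sgd_length :: "real \<Rightarrow> real \<Rightarrow> real \<Rightarrow> real \<Rightarrow> real \<Rightarrow> nat" where
  "sgd_length c1 L V \<epsilon> \<sigma> = nat \<lceil>(100 * c1\<^sup>2 + 3) * (V / \<epsilon>\<^sup>2 * (ln (3 * L / \<sigma>)) ^ 3)\<rceil>"

text \<open>The argument \<open>\<sigma>\<close> is the parameter after a possible replacement by \<open>sigma_used\<close>.  A gradient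
  of a component of \<open>G\<close> costs one gradient of the corresponding component of \<open>f\<close>.\<close>

definition natasha_prune ::
  "real \<Rightarrow> 'a::euclidean_space subroutine \<Rightarrow> nat \<Rightarrow> (nat \<Rightarrow> 'a \<Rightarrow> real) \<Rightarrow> ('a \<Rightarrow> ereal)
    \<Rightarrow> real \<Rightarrow> real \<Rightarrow> real \<Rightarrow> real \<Rightarrow> 'a \<Rightarrow> real \<Rightarrow> 'a run" where
  "natasha_prune c1 sgd n fs \<psi> L \<sigma> V \<Delta> x0 \<epsilon> =
    (let B = epoch_length V \<epsilon>;
         p = sub_epoch_count L \<sigma> B;
         \<alpha> = learning_rate L \<sigma> p;
         T' = epoch_count (natasha_length L V \<Delta> \<epsilon> \<sigma>) B
     in do {
       ((yhat, yplus), c) \<leftarrow> natasha_full n fs \<psi> \<sigma> x0 B p T' \<alpha>;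
       (xout, c') \<leftarrow> sgd n (\<lambda>i x. fs i x + \<sigma> * (norm (x - yhat))\<^sup>2) \<psi> yhat \<sigma> (3 * L)
                          (sgd_length c1 L V \<epsilon> \<sigma>);
       return_pmf (xout, c + c')
     })"

text \<open>The constant in the bound on the gradient complexity; it is a function of \<open>L\<close>, \<open>\<Delta>\<close>, \<open>V\<close> and
  of the constant of the subroutine only.\<close>

definition complexity_constant :: "real \<Rightarrow> real \<Rightarrow> real \<Rightarrow> real \<Rightarrow> real" where
  "complexity_constant c1 L \<Delta> V =
     10^9 * (\<Delta> * (L * sqrt V + (L * V) powr (2/3))) + 10^5 * ((1 + c1\<^sup>2) * V powr (3/2))"

end

theory Submission
  imports Defs
begin

text \<open>Each sub-epoch started at \<open>z\<close> runs proximal SVRG on the \<open>\<sigma>\<close>-strongly convex function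
  \<open>F(x) + \<sigma> \<parallel>x - z\<parallel>\<^sup>2\<close> with minimizer \<open>c(z)\<close>, and decreases \<open>F\<close> in expectation by
  \<open>\<sigma>/4 \<parallel>z - c(z)\<parallel>\<^sup>2 + \<sigma> \<parallel>z' - z\<parallel>\<^sup>2\<close>, up to the variance \<open>\<alpha> L\<^sup>2 \<parallel>z' - x\<parallel>\<^sup>2\<close> caused by the distance to
  the snapshot \<open>x\<close> and the error \<open>\<parallel>\<mu> - \<nabla>f(x)\<parallel>\<^sup>2 / (2 \<sigma>)\<close> of the mini batch.  The distance to the snapshot
  is paid for by the moves \<open>\<sigma> \<parallel>z' - z\<parallel>\<^sup>2\<close> within the epoch, and the mini batch error is at most
  \<open>V / (2 \<sigma> B)\<close> in expectation.  Telescoping bounds the average of \<open>\<sigma>\<^sup>2 \<parallel>z - c(z)\<parallel>\<^sup>2\<close> over all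
  starting points \<open>z\<close> by a small multiple of \<open>\<epsilon>\<^sup>2\<close>.  For a random such \<open>z\<close> the second term of the guarantee of the
  subroutine is therefore small even without its exponential factor, and an error bound for strongly
  convex composite functions turns a small gradient mapping of \<open>G\<close> into a small one of \<open>F\<close>.\<close>

section \<open>Gradients and proximal steps\<close>

text \<open>The minimizer \<open>center z\<close> is the proximal point of \<open>F\<close> at
  \<open>z\<close> with step 1/(2\<sigma>); \<sigma> times its distance to \<open>z\<close> is half
  the gradient norm of the Moreau envelope of \<open>F\<close>, which measures stationarity although
  \<open>F\<close> may be neither convex nor smooth. The obstacle inside an epoch is that the mini
  batch is drawn once: its error is a bias common to all steps, which does not average out over the
  index \<open>i\<close>. It is absorbed by strong convexity, after which the distance to the center
  has the same coefficient before and after a step, so that sums over the iterates telescope; the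
  random choice of an iterate turns such sums into expectations. The lower bound on the \<sigma> in
  use says that the condition number L/\<sigma> is at most sqrt V / \<epsilon>; every inequality
  between the parameters, including the losses by rounding, rests on this. All runs before the
  subroutine have finite support, so their expectations are finite sums. The subroutine is an
  arbitrary distribution, so integrability is carried along from there on.\<close>

lemma GDERIV_unique:
  fixes f :: "'a::euclidean_space \<Rightarrow> real"
  assumes "GDERIV f x :> D" "GDERIV f x :> D'"
  shows "D = D'"
proof -
  have "(\<lambda>h. h \<bullet> D) = (\<lambda>h. h \<bullet> D')"
    using assms unfolding gderiv_def by (rule has_derivative_unique)
  then have "(D - D') \<bullet> D = (D - D') \<bullet> D'" by metis
  then have "(D - D') \<bullet> (D - D') = 0" by (simp add: inner_diff_right)
  then show ?thesis by simp
qed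

lemma grad_eqI: "GDERIV f x :> D \<Longrightarrow> grad f x = D"
  unfolding grad_def by (blast intro: GDERIV_unique)

lemma GDERIV_grad:
  fixes f :: "'a::euclidean_space \<Rightarrow> real"
  assumes "f differentiable (at x)"
  shows "GDERIV f x :> grad f x"
proof -
  obtain f' where f': "(f has_derivative f') (at x)"
    using assms by (auto simp: differentiable_def)
  interpret bounded_linear f' using f' by (rule has_derivative_bounded_linear)
  have "f' = (\<lambda>h. h \<bullet> (\<Sum>b\<in>Basis. f' b *\<^sub>R b))"
  proof
    fix h :: 'a
    have "f' h = f' (\<Sum>b\<in>Basis. (h \<bullet> b) *\<^sub>R b)" by (simp add: euclidean_representation)
    also have "\<dots> = (\<Sum>b\<in>Basis. (h \<bullet> b) * f' b)" by (simp add: sum scaleR)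
    also have "\<dots> = h \<bullet> (\<Sum>b\<in>Basis. f' b *\<^sub>R b)" by (simp add: inner_sum_right mult.commute)
    finally show "f' h = h \<bullet> (\<Sum>b\<in>Basis. f' b *\<^sub>R b)" .
  qed
  with f' have "GDERIV f x :> (\<Sum>b\<in>Basis. f' b *\<^sub>R b)" unfolding gderiv_def by simp
  with grad_eqI[OF this] show ?thesis by simp
qed

lemma GDERIV_differentiable: "GDERIV f x :> D \<Longrightarrow> f differentiable (at x)"
  unfolding gderiv_def differentiable_def by blast

lemma GDERIV_norm_power2:
  fixes y :: "'a::euclidean_space"
  shows "GDERIV (\<lambda>x. c * (norm (x - y))\<^sup>2) x :> (2 * c) *\<^sub>R (x - y)"
  unfolding gderiv_def power2_norm_eq_inner
  by (auto intro!: derivative_eq_intros simp: inner_commute algebra_simps)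

lemma GDERIV_average:
  fixes fs :: "nat \<Rightarrow> 'a::euclidean_space \<Rightarrow> real"
  assumes "\<And>i. i \<in> {1..n} \<Longrightarrow> GDERIV (fs i) x :> D i"
  shows "GDERIV (average n fs) x :> (1 / real n) *\<^sub>R (\<Sum>i=1..n. D i)"
proof -
  have "FDERIV (\<lambda>x. \<Sum>i=1..n. fs i x) x :> (\<lambda>h. \<Sum>i=1..n. h \<bullet> D i)"
    using assms unfolding gderiv_def by (intro has_derivative_sum) auto
  then have "FDERIV (\<lambda>x. (\<Sum>i=1..n. fs i x) / real n) x :> (\<lambda>h. (\<Sum>i=1..n. h \<bullet> D i) / real n)"
    unfolding divide_inverse by (rule has_derivative_mult_left)
  then show ?thesis
    unfolding gderiv_def by (simp add: average_def[abs_def] inner_sum_right)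
qed

lemma smooth_upper_bound:
  fixes f :: "'a::euclidean_space \<Rightarrow> real"
  assumes "smooth L f"
  shows "f y \<le> f x + grad f x \<bullet> (y - x) + L / 2 * (norm (y - x))\<^sup>2"
proof -
  let ?d = "y - x"
  \<comment> \<open>Along the segment the claimed quadratic bound is subtracted; the Lipschitz
    condition makes the derivative \<le> 0 on [0, 1], in place of integrating the gradient.\<close>
  let ?\<phi> = "\<lambda>t. f (x + t *\<^sub>R ?d) - t * (grad f x \<bullet> ?d) - L / 2 * t\<^sup>2 * (norm ?d)\<^sup>2"
  have "?\<phi> 1 \<le> ?\<phi> 0"
  proof (rule DERIV_nonpos_imp_nonincreasing[of 0 1 ?\<phi>])
    fix t :: real assume t: "0 \<le> t" "t \<le> 1"
    let ?g = "grad f (x + t *\<^sub>R ?d)"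
    have "FDERIV f (x + t *\<^sub>R ?d) :> (\<lambda>h. h \<bullet> ?g)"
      using assms GDERIV_grad unfolding smooth_def gderiv_def by blast
    moreover have "((\<lambda>t. x + t *\<^sub>R ?d) has_derivative (\<lambda>s. s *\<^sub>R ?d)) (at t)"
      by (auto intro!: derivative_eq_intros)
    ultimately have "((\<lambda>t. f (x + t *\<^sub>R ?d)) has_derivative (\<lambda>s. (s *\<^sub>R ?d) \<bullet> ?g)) (at t)"
      using has_derivative_compose[of "\<lambda>t. x + t *\<^sub>R ?d"] by blast
    then have "((\<lambda>t. f (x + t *\<^sub>R ?d)) has_real_derivative ?d \<bullet> ?g) (at t)"
      by (simp add: has_field_derivative_def mult_commute_abs)
    then have "(?\<phi> has_real_derivative
        ?d \<bullet> ?g - grad f x \<bullet> ?d - L * t * (norm ?d)\<^sup>2) (at t)"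
      by (auto intro!: derivative_eq_intros)
    moreover have "?d \<bullet> ?g - grad f x \<bullet> ?d - L * t * (norm ?d)\<^sup>2 \<le> 0"
    proof -
      have "?d \<bullet> ?g - grad f x \<bullet> ?d = (?g - grad f x) \<bullet> ?d"
        by (metis inner_commute inner_diff_left)
      also have "\<dots> \<le> norm (?g - grad f x) * norm ?d" by (rule norm_cauchy_schwarz)
      also have "\<dots> \<le> (L * norm (x + t *\<^sub>R ?d - x)) * norm ?d"
        using assms unfolding smooth_def by (intro mult_right_mono) (blast, simp)
      also have "\<dots> = L * t * (norm ?d)\<^sup>2" using t by (simp add: power2_eq_square)
      finally show ?thesis by simp
    qed
    ultimately show "\<exists>y. (?\<phi> has_real_derivative y) (at t) \<and> y \<le> 0" by blast
  qed simp
  then show ?thesis by simp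
qed

lemma norm_le_if_inner_le:
  fixes w v :: "'a::real_inner"
  assumes "w \<bullet> w \<le> v \<bullet> w" shows "norm w \<le> norm v"
proof (cases "w = 0")
  case False
  have "norm w * norm w \<le> norm v * norm w"
    using assms norm_cauchy_schwarz[of v w] by (simp add: dot_square_norm power2_eq_square)
  then show ?thesis using False by simp
qed simp

text \<open>At the combination the linear terms of the two lower bounds cancel, since (1 - t) t + t
  (t - 1) = 0. \<open>strongly_convex\<close> is phrased by combinations because
  \<open>\<psi>\<close> has no gradient, so gradient bounds have to be brought into this
  form.\<close>

lemma lower_bound_imp_convex_combination:
  fixes g :: "'a::euclidean_space \<Rightarrow> real"
  assumes lb: "\<And>x y. g y \<ge> g x + A x \<bullet> (y - x) + \<sigma> / 2 * (norm (y - x))\<^sup>2"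
    and t: "0 \<le> t" "t \<le> 1"
  shows "g ((1 - t) *\<^sub>R x + t *\<^sub>R y) \<le> (1 - t) * g x + t * g y - \<sigma> / 2 * t * (1 - t) * (norm (x - y))\<^sup>2"
proof -
  define z where "z = (1 - t) *\<^sub>R x + t *\<^sub>R y"
  have "x - z = t *\<^sub>R (x - y)" and "y - z = (t - 1) *\<^sub>R (x - y)"
    by (simp_all add: z_def algebra_simps)
  then have x: "g x \<ge> g z + t * (A z \<bullet> (x - y)) + \<sigma> / 2 * (t\<^sup>2 * (norm (x - y))\<^sup>2)"
    and y: "g y \<ge> g z + (t - 1) * (A z \<bullet> (x - y)) + \<sigma> / 2 * ((t - 1)\<^sup>2 * (norm (x - y))\<^sup>2)"
    using lb[of z x] lb[of z y] by (simp_all add: power_mult_distrib)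
  have "(1 - t) * (g z + t * (A z \<bullet> (x - y)) + \<sigma> / 2 * (t\<^sup>2 * (norm (x - y))\<^sup>2))
      + t * (g z + (t - 1) * (A z \<bullet> (x - y)) + \<sigma> / 2 * ((t - 1)\<^sup>2 * (norm (x - y))\<^sup>2))
      \<le> (1 - t) * g x + t * g y"
    using t x y by (intro add_mono mult_left_mono) auto
  also have "(1 - t) * (g z + t * (A z \<bullet> (x - y)) + \<sigma> / 2 * (t\<^sup>2 * (norm (x - y))\<^sup>2))
      + t * (g z + (t - 1) * (A z \<bullet> (x - y)) + \<sigma> / 2 * ((t - 1)\<^sup>2 * (norm (x - y))\<^sup>2))
      = g z + \<sigma> / 2 * t * (1 - t) * (norm (x - y))\<^sup>2"
    by (simp add: power2_eq_square algebra_simps add_divide_distrib diff_divide_distrib)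
  finally show ?thesis unfolding z_def by simp
qed

section \<open>Subgradients and monotonicity of the proximal step\<close>

locale proximable =
  fixes \<psi> :: "'a::euclidean_space \<Rightarrow> ereal"
  assumes proper: "proper_convex \<psi>" and attained: "prox_attained \<psi>"
begin

definition dom :: "'a set" where "dom = {x. \<psi> x < \<infinity>}"

text \<open>Outside of \<open>dom\<close> this is the default 0 of \<open>real_of_ereal\<close>,
  hence the membership assumptions below; on \<open>dom\<close> it permits real arithmetic.\<close>

definition val :: "'a \<Rightarrow> real" where "val x = real_of_ereal (\<psi> x)"

definition subgradient :: "'a \<Rightarrow> 'a \<Rightarrow> bool" where
  "subgradient v x \<longleftrightarrow> x \<in> dom \<and> (\<forall>u\<in>dom. val x + v \<bullet> (u - x) \<le> val u)"

lemma eq_val: "x \<in> dom \<Longrightarrow> \<psi> x = ereal (val x)"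
  using proper unfolding dom_def val_def proper_convex_def by (cases "\<psi> x") auto

lemma eq_infinity: "x \<notin> dom \<Longrightarrow> \<psi> x = \<infinity>"
  by (simp add: dom_def)

lemma dom_nonempty: "\<exists>x. x \<in> dom"
  using proper unfolding dom_def proper_convex_def by auto

lemma convex_combination:
  assumes "x \<in> dom" "y \<in> dom" "0 < t" "t < 1"
  shows "(1 - t) *\<^sub>R x + t *\<^sub>R y \<in> dom"
    and "val ((1 - t) *\<^sub>R x + t *\<^sub>R y) \<le> (1 - t) * val x + t * val y"
proof -
  have "\<psi> ((1 - t) *\<^sub>R x + t *\<^sub>R y) \<le> ereal (1 - t) * \<psi> x + ereal t * \<psi> y"
    using proper assms(3,4) unfolding proper_convex_def by auto
  then have *: "\<psi> ((1 - t) *\<^sub>R x + t *\<^sub>R y) \<le> ereal ((1 - t) * val x + t * val y)"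
    by (simp add: eq_val assms(1,2))
  then show dom: "(1 - t) *\<^sub>R x + t *\<^sub>R y \<in> dom"
    unfolding dom_def using le_less_trans less_ereal.simps(4) by blast
  show "val ((1 - t) *\<^sub>R x + t *\<^sub>R y) \<le> (1 - t) * val x + t * val y"
    using * unfolding eq_val[OF dom] by simp
qed

lemma subgradient_mono:
  assumes "subgradient v x" "subgradient w y"
  shows "0 \<le> (v - w) \<bullet> (x - y)"
proof -
  have "val x + v \<bullet> (y - x) \<le> val y" "val y + w \<bullet> (x - y) \<le> val x"
    using assms unfolding subgradient_def by auto
  then show ?thesis by (simp add: algebra_simps)
qed

text \<open>Compare the minimizer \<open>y\<close> with the points \<open>y + t (u - y)\<close> and let \<open>t\<close> tend to 0.\<close>

lemma prox_step_subgradient: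
  assumes "\<eta> > 0"
  shows "subgradient ((1 / \<eta>) *\<^sub>R (x - prox_step \<psi> \<eta> v x) - v) (prox_step \<psi> \<eta> v x)"
proof -
  let ?y = "prox_step \<psi> \<eta> v x"
  \<comment> \<open>\<open>arg_min\<close> is a choice operator; attainment is what makes its value
    a minimizer.\<close>
  have "is_arg_min (prox_objective \<psi> \<eta> v x) (\<lambda>_. True) ?y"
    using attained assms unfolding prox_attained_def prox_step_def arg_min_def by (metis someI)
  then have min: "prox_objective \<psi> \<eta> v x ?y \<le> prox_objective \<psi> \<eta> v x u" for u
    unfolding is_arg_min_def by (auto simp: not_less)
  obtain z where z: "z \<in> dom" using dom_nonempty by blast
  have "\<psi> ?y < \<infinity>"
    using min[of z] unfolding prox_objective_def eq_val[OF z] by (cases "\<psi> ?y") auto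
  then have ydom: "?y \<in> dom" by (simp add: dom_def)
  have minr: "val ?y + (v \<bullet> ?y + (norm (?y - x))\<^sup>2 / (2 * \<eta>))
      \<le> val u + (v \<bullet> u + (norm (u - x))\<^sup>2 / (2 * \<eta>))" if "u \<in> dom" for u
    using min[of u] unfolding prox_objective_def eq_val[OF that] eq_val[OF ydom] by simp
  have "val ?y + ((1 / \<eta>) *\<^sub>R (x - ?y) - v) \<bullet> (u - ?y) \<le> val u" if u: "u \<in> dom" for u
  proof -
    let ?c = "val u - val ?y - ((1 / \<eta>) *\<^sub>R (x - ?y) - v) \<bullet> (u - ?y)"
    let ?q = "(norm (u - ?y))\<^sup>2 / (2 * \<eta>)"
    have cc: "((1 / \<eta>) *\<^sub>R (x - ?y) - v) \<bullet> w = - ((?y - x) \<bullet> w) / \<eta> - v \<bullet> w" for w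
      by (simp add: inner_diff_left diff_divide_distrib)
    have "0 \<le> ?c + t * ?q" if t: "0 < t" "t < 1" for t
    proof -
      let ?z = "(1 - t) *\<^sub>R ?y + t *\<^sub>R u"
      have nz: "(norm (?z - x))\<^sup>2
          = (norm (?y - x))\<^sup>2 + 2 * t * ((?y - x) \<bullet> (u - ?y)) + t\<^sup>2 * (norm (u - ?y))\<^sup>2"
      proof -
        have "?z - x = (?y - x) + t *\<^sub>R (u - ?y)" by (simp add: algebra_simps)
        then show ?thesis
          by (simp only: power2_norm_eq_inner)
             (simp add: inner_add_left inner_add_right inner_commute power2_eq_square algebra_simps)
      qed
      have vz: "v \<bullet> ?z = v \<bullet> ?y + t * (v \<bullet> (u - ?y))" by (simp add: algebra_simps)
      have "val ?y + (v \<bullet> ?y + (norm (?y - x))\<^sup>2 / (2 * \<eta>))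
          \<le> (1 - t) * val ?y + t * val u + (v \<bullet> ?z + (norm (?z - x))\<^sup>2 / (2 * \<eta>))"
        using minr[OF convex_combination(1)[OF ydom u t]] convex_combination(2)[OF ydom u t]
        by linarith
      then have "0 \<le> t * (val u - val ?y) + t * (v \<bullet> (u - ?y))
          + (2 * t * ((?y - x) \<bullet> (u - ?y)) + t\<^sup>2 * (norm (u - ?y))\<^sup>2) / (2 * \<eta>)"
        unfolding nz vz by (simp add: add_divide_distrib left_diff_distrib right_diff_distrib)
      also have "\<dots> = t * (?c + t * ?q)"
        unfolding cc using assms by (simp add: field_simps power2_eq_square)
      finally show ?thesis using t by (simp add: zero_le_mult_iff)
    qed
    then have ev: "\<forall>\<^sub>F t in at_right 0. 0 \<le> ?c + t * ?q"
      unfolding eventually_at_right_field by (intro exI[of _ 1]) auto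
    have "((\<lambda>t. ?c + t * ?q) \<longlongrightarrow> ?c + 0 * ?q) (at_right 0)"
      by (intro tendsto_intros)
    then have "0 \<le> ?c + 0 * ?q"
      using ev by (rule tendsto_lowerbound) auto
    then show ?thesis by simp
  qed
  with ydom show ?thesis unfolding subgradient_def by blast
qed

lemma prox_step_dom: "\<eta> > 0 \<Longrightarrow> prox_step \<psi> \<eta> v x \<in> dom"
  using prox_step_subgradient unfolding subgradient_def by blast

text \<open>The proximal step is a resolvent: \<eta> times the difference of the two subgradients is
  the difference of the forward points minus that of the results. Monotonicity gives firm
  nonexpansiveness, and Cauchy-Schwarz the rest.\<close>

lemma prox_step_nonexpansive:
  assumes "\<eta> > 0"
  shows "norm (prox_step \<psi> \<eta> v x - prox_step \<psi> \<eta> w y) \<le> norm ((x - \<eta> *\<^sub>R v) - (y - \<eta> *\<^sub>R w))"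
proof (rule norm_le_if_inner_le)
  let ?p = "prox_step \<psi> \<eta> v x" and ?q = "prox_step \<psi> \<eta> w y"
  have "0 \<le> ((1 / \<eta>) *\<^sub>R (x - ?p) - v - ((1 / \<eta>) *\<^sub>R (y - ?q) - w)) \<bullet> (?p - ?q)"
    by (intro subgradient_mono prox_step_subgradient assms)
  then have "0 \<le> \<eta> * (((1 / \<eta>) *\<^sub>R (x - ?p) - v - ((1 / \<eta>) *\<^sub>R (y - ?q) - w)) \<bullet> (?p - ?q))"
    using assms by simp
  also have "\<dots> = ((x - \<eta> *\<^sub>R v) - (y - \<eta> *\<^sub>R w) - (?p - ?q)) \<bullet> (?p - ?q)"
    using assms by (simp add: inner_diff_left right_diff_distrib)
  finally show "(?p - ?q) \<bullet> (?p - ?q) \<le> ((x - \<eta> *\<^sub>R v) - (y - \<eta> *\<^sub>R w)) \<bullet> (?p - ?q)"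
    by (simp add: inner_diff_left)
qed

text \<open>This bridges the step C/(3L) of the subroutine and the step C/L of the theorem. Both
  proximal points use the same gradient, so monotonicity of the subgradients says that a product of
  two factors is nonnegative; if the longer step gave the larger norm, the factors would have
  opposite signs.\<close>

lemma norm_gradient_mapping_antimono:
  assumes "0 < \<eta>" "\<eta> \<le> \<eta>'"
  shows "norm (gradient_mapping \<psi> h \<eta>' x) \<le> norm (gradient_mapping \<psi> h \<eta> x)"
proof -
  let ?v = "grad h x"
  let ?p = "prox_step \<psi> \<eta> ?v x" and ?q = "prox_step \<psi> \<eta>' ?v x"
  let ?d = "gradient_mapping \<psi> h \<eta> x" and ?e = "gradient_mapping \<psi> h \<eta>' x"
  have \<eta>': "0 < \<eta>'" using assms by simp
  have "0 \<le> ((1 / \<eta>) *\<^sub>R (x - ?p) - ?v - ((1 / \<eta>') *\<^sub>R (x - ?q) - ?v)) \<bullet> (?p - ?q)"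
    by (intro subgradient_mono prox_step_subgradient assms \<eta>')
  also have "\<dots> = (?d - ?e) \<bullet> (\<eta>' *\<^sub>R ?e - \<eta> *\<^sub>R ?d)"
    using assms(1) \<eta>' by (simp add: gradient_mapping_def)
  also have "\<dots> = (\<eta> + \<eta>') * (?d \<bullet> ?e) - \<eta> * (norm ?d)\<^sup>2 - \<eta>' * (norm ?e)\<^sup>2"
    by (simp add: power2_norm_eq_inner inner_diff_left inner_diff_right inner_commute algebra_simps)
  also have "\<dots> \<le> (\<eta> + \<eta>') * (norm ?d * norm ?e) - \<eta> * (norm ?d)\<^sup>2 - \<eta>' * (norm ?e)\<^sup>2"
    using assms by (simp add: norm_cauchy_schwarz)
  also have "\<dots> = (norm ?e - norm ?d) * (\<eta> * norm ?d - \<eta>' * norm ?e)"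
    by (simp add: power2_eq_square algebra_simps)
  finally have *: "0 \<le> (norm ?e - norm ?d) * (\<eta> * norm ?d - \<eta>' * norm ?e)" .
  show ?thesis
  proof (rule ccontr)
    assume gt: "\<not> ?thesis"
    then have "\<eta>' * norm ?d < \<eta>' * norm ?e" using \<eta>' by simp
    moreover have "\<eta> * norm ?d \<le> \<eta>' * norm ?d" using assms by (simp add: mult_right_mono)
    ultimately have "\<eta> * norm ?d - \<eta>' * norm ?e < 0" by linarith
    with gt have "(norm ?e - norm ?d) * (\<eta> * norm ?d - \<eta>' * norm ?e) < 0"
      by (intro mult_pos_neg) auto
    with * show False by simp
  qed
qed

text \<open>The proximal gradient step with a short step size is a contraction, and its fixed point
  solves the inclusion.\<close>

lemma ex_stationary_point:
  fixes A :: "'a \<Rightarrow> 'a"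
  assumes "0 < \<sigma>" and mono: "\<And>x y. \<sigma> * (norm (x - y))\<^sup>2 \<le> (A x - A y) \<bullet> (x - y)"
    and lip: "\<And>x y. norm (A x - A y) \<le> M * norm (x - y)"
    and "\<sigma> \<le> M"
  shows "\<exists>x. subgradient (- A x) x"
proof -
  \<comment> \<open>This choice minimizes the squared contraction factor
    \<open>1 - 2 * \<eta> * \<sigma> + \<eta>\<^sup>2 * M\<^sup>2\<close>; the minimum is
    \<open>c\<close> below.\<close>
  define \<eta> where "\<eta> = \<sigma> / M\<^sup>2"
  have M: "0 < M" using assms by simp
  have \<eta>: "\<eta> > 0" using assms(1) M by (simp add: \<eta>_def)
  define c where "c = 1 - \<sigma>\<^sup>2 / M\<^sup>2"
  have c: "0 \<le> c" "c < 1"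
    using assms(1,4) M by (auto simp: c_def power_mono)
  let ?T = "\<lambda>x. prox_step \<psi> \<eta> (A x) x"
  have "dist (?T x) (?T y) \<le> sqrt c * dist x y" for x y
  proof -
    let ?u = "x - y" and ?D = "A x - A y"
    have "(norm ((x - \<eta> *\<^sub>R A x) - (y - \<eta> *\<^sub>R A y)))\<^sup>2 = (norm (?u - \<eta> *\<^sub>R ?D))\<^sup>2"
      by (simp add: algebra_simps)
    also have "\<dots> = (norm ?u)\<^sup>2 - 2 * \<eta> * (?D \<bullet> ?u) + \<eta>\<^sup>2 * (norm ?D)\<^sup>2"
      by (simp only: power2_norm_eq_inner)
         (simp add: inner_diff_left inner_diff_right inner_commute power2_eq_square algebra_simps)
    also have "\<dots> \<le> (norm ?u)\<^sup>2 - 2 * \<eta> * (\<sigma> * (norm ?u)\<^sup>2) + \<eta>\<^sup>2 * (M * norm ?u)\<^sup>2"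
      using \<eta> by (intro add_mono diff_mono mult_left_mono mono power_mono lip) auto
    also have "\<dots> = c * (norm ?u)\<^sup>2"
      using M by (simp add: \<eta>_def c_def field_simps power2_eq_square)
    finally have "norm ((x - \<eta> *\<^sub>R A x) - (y - \<eta> *\<^sub>R A y)) \<le> sqrt (c * (norm ?u)\<^sup>2)"
      by (simp add: real_le_rsqrt)
    also have "\<dots> = sqrt c * norm ?u" by (simp add: real_sqrt_mult)
    finally show ?thesis
      using prox_step_nonexpansive[OF \<eta>, of "A x" x "A y" y] by (simp add: dist_norm)
  qed
  then obtain x where "?T x = x"
    using banach_fix_type[of "sqrt c" ?T] c by auto
  then show ?thesis
    using prox_step_subgradient[OF \<eta>, of x "A x"] by (intro exI[of _ x]) simp
qed

end

section \<open>The proximal step of one iteration\<close>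

lemma inner_le_weighted_norms:
  fixes a b :: "'a::real_inner"
  assumes "c > 0"
  shows "a \<bullet> b \<le> c * (norm a)\<^sup>2 + (norm b)\<^sup>2 / (4 * c)"
proof -
  have "0 \<le> (norm ((2 * c) *\<^sub>R a - b))\<^sup>2" by simp
  also have "\<dots> = 4 * c * (c * (norm a)\<^sup>2 + (norm b)\<^sup>2 / (4 * c) - a \<bullet> b)"
    using assms unfolding power2_norm_eq_inner
    by (simp add: inner_diff_left inner_diff_right inner_commute field_simps)
  finally show ?thesis using assms by (simp add: zero_le_mult_iff)
qed

lemma norm_diff_power2_expand:
  fixes x y z :: "'a::real_inner"
  shows "(norm (y - z))\<^sup>2 = (norm (x - z))\<^sup>2 + 2 * ((x - z) \<bullet> (y - x)) + (norm (y - x))\<^sup>2"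
  unfolding power2_norm_eq_inner by (simp add: inner_diff_left inner_diff_right inner_commute)

text \<open>Variance is at most the second moment about 0. Applied to gradient differences between
  an iterate and the snapshot, it bounds the variance of the SVRG estimator.\<close>

lemma sum_norm_deviation_le:
  fixes a :: "'i \<Rightarrow> 'a::real_inner"
  assumes "finite A"
  shows "(\<Sum>i\<in>A. (norm (a i - (1 / real (card A)) *\<^sub>R sum a A))\<^sup>2) \<le> (\<Sum>i\<in>A. (norm (a i))\<^sup>2)"
proof (cases "A = {}")
  case False
  let ?k = "real (card A)" and ?s = "sum a A"
  have k: "?k > 0" using assms False by (simp add: card_gt_0_iff)
  have "(\<Sum>i\<in>A. (norm (a i - (1 / ?k) *\<^sub>R ?s))\<^sup>2)
      = (\<Sum>i\<in>A. (norm (a i))\<^sup>2 - 2 / ?k * (a i \<bullet> ?s) + (norm ?s)\<^sup>2 / ?k\<^sup>2)"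
    unfolding power2_norm_eq_inner
    by (intro sum.cong) (auto simp: inner_diff_left inner_diff_right inner_commute power2_eq_square)
  also have "\<dots> = (\<Sum>i\<in>A. (norm (a i))\<^sup>2) - (norm ?s)\<^sup>2 / ?k"
  proof -
    have "(\<Sum>i\<in>A. 2 / ?k * (a i \<bullet> ?s)) = 2 / ?k * (norm ?s)\<^sup>2"
      by (simp add: sum_distrib_left[symmetric] inner_sum_left power2_norm_eq_inner
          del: times_divide_eq_left)
    then show ?thesis
      using k by (simp add: sum.distrib sum_subtractf power2_eq_square)
  qed
  finally show ?thesis using k by simp
qed simp

lemma grad_add_norm_power2:
  fixes h :: "'a::euclidean_space \<Rightarrow> real"
  assumes "h differentiable (at x)"
  shows "grad (\<lambda>x. h x + c * (norm (x - y))\<^sup>2) x = grad h x + (2 * c) *\<^sub>R (x - y)"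
  by (intro grad_eqI GDERIV_add GDERIV_grad GDERIV_norm_power2 assms)

text \<open>The \<sigma> of this locale is the one used by the algorithm, in the end
  \<open>sigma_used\<close>, and not the original parameter of \<open>f\<close>.\<close>

locale composite_problem = proximable \<psi> for \<psi> :: "'a::euclidean_space \<Rightarrow> ereal" +
  fixes n :: nat and fs :: "nat \<Rightarrow> 'a \<Rightarrow> real" and L \<sigma> :: real
  assumes n: "n \<ge> 1"
    and smooth: "\<And>i. i \<in> {1..n} \<Longrightarrow> smooth L (fs i)"
    and \<sigma>_pos: "0 < \<sigma>" and \<sigma>_le: "\<sigma> \<le> L"
    and nonconvex: "nonconvex \<sigma> (average n fs)"
begin

abbreviation "f \<equiv> average n fs"

lemma L_pos: "0 < L" using \<sigma>_pos \<sigma>_le by simp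

lemma f_differentiable: "f differentiable (at x)"
  using nonconvex unfolding nonconvex_def by blast

lemma fs_differentiable: "i \<in> {1..n} \<Longrightarrow> fs i differentiable (at x)"
  using smooth unfolding smooth_def by blast

lemma grad_f: "grad f x = (1 / real n) *\<^sub>R (\<Sum>i=1..n. grad (fs i) x)"
  by (intro grad_eqI GDERIV_average GDERIV_grad fs_differentiable)

lemma grad_f_lipschitz: "norm (grad f x - grad f y) \<le> L * norm (x - y)"
proof -
  have "norm (grad f x - grad f y) = norm (\<Sum>i=1..n. grad (fs i) x - grad (fs i) y) / real n"
    by (simp add: grad_f sum_subtractf scaleR_diff_right[symmetric] divide_inverse mult.commute)
  also have "\<dots> \<le> (\<Sum>i=1..n. L * norm (x - y)) / real n"
    using smooth unfolding smooth_def by (intro divide_right_mono sum_norm_le) auto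
  finally show ?thesis using n by simp
qed

lemma smooth_f: "smooth L f"
  unfolding smooth_def using f_differentiable grad_f_lipschitz by blast

definition reg :: "'a \<Rightarrow> 'a \<Rightarrow> real" where
  "reg z x = f x + \<sigma> * (norm (x - z))\<^sup>2"

definition reg_grad :: "'a \<Rightarrow> 'a \<Rightarrow> 'a" where
  "reg_grad z x = grad f x + (2 * \<sigma>) *\<^sub>R (x - z)"

text \<open>Stationarity is the defining property because existence comes from the fixed point
  argument of \<open>ex_stationary_point\<close>; minimality is then derived in
  \<open>objective_center\<close>.\<close>

definition center :: "'a \<Rightarrow> 'a" where
  "center z = (SOME x. subgradient (- reg_grad z x) x)"

definition objective :: "'a \<Rightarrow> 'a \<Rightarrow> real" where
  "objective z x = val x + reg z x"

text \<open>The regularizer is \<open>2 * \<sigma>\<close>-strongly convex, and the nonconvexity of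
  \<open>f\<close> consumes one \<sigma> of it.\<close>

lemma reg_lower: "reg z y \<ge> reg z x + reg_grad z x \<bullet> (y - x) + \<sigma> / 2 * (norm (y - x))\<^sup>2"
proof -
  have "f y \<ge> f x + grad f x \<bullet> (y - x) - \<sigma> / 2 * (norm (y - x))\<^sup>2"
    using nonconvex unfolding nonconvex_def by (metis norm_minus_commute)
  moreover have "reg_grad z x \<bullet> (y - x) = grad f x \<bullet> (y - x) + 2 * \<sigma> * ((x - z) \<bullet> (y - x))"
    by (simp add: reg_grad_def inner_add_left)
  moreover have "\<sigma> * (norm (y - z))\<^sup>2
      = \<sigma> * (norm (x - z))\<^sup>2 + 2 * \<sigma> * ((x - z) \<bullet> (y - x)) + \<sigma> * (norm (y - x))\<^sup>2"
    by (subst norm_diff_power2_expand[of y z x]) (simp add: distrib_left)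
  ultimately show ?thesis unfolding reg_def by linarith
qed

text \<open>The smoothness constants are \<open>L\<close> for \<open>f\<close> and 2\<sigma> \<le>
  2L for the regularizer; this is the \<open>3 * L\<close> handed to the subroutine.\<close>

lemma reg_upper: "reg z y \<le> reg z x + reg_grad z x \<bullet> (y - x) + 3 * L / 2 * (norm (y - x))\<^sup>2"
proof -
  have "f y \<le> f x + grad f x \<bullet> (y - x) + L / 2 * (norm (y - x))\<^sup>2"
    by (rule smooth_upper_bound[OF smooth_f])
  moreover have "reg_grad z x \<bullet> (y - x) = grad f x \<bullet> (y - x) + 2 * \<sigma> * ((x - z) \<bullet> (y - x))"
    by (simp add: reg_grad_def inner_add_left)
  moreover have "\<sigma> * (norm (y - z))\<^sup>2
      = \<sigma> * (norm (x - z))\<^sup>2 + 2 * \<sigma> * ((x - z) \<bullet> (y - x)) + \<sigma> * (norm (y - x))\<^sup>2"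
    by (subst norm_diff_power2_expand[of y z x]) (simp add: distrib_left)
  moreover have "\<sigma> * (norm (y - x))\<^sup>2 \<le> L * (norm (y - x))\<^sup>2"
    using \<sigma>_le by (simp add: mult_right_mono)
  ultimately show ?thesis unfolding reg_def by linarith
qed

lemma reg_grad_mono: "\<sigma> * (norm (x - y))\<^sup>2 \<le> (reg_grad z x - reg_grad z y) \<bullet> (x - y)"
proof -
  have "reg_grad z x \<bullet> (y - x) = - (reg_grad z x \<bullet> (x - y))" by (simp add: inner_diff_right)
  then show ?thesis
    using reg_lower[of z x y] reg_lower[of z y x]
    by (simp add: norm_minus_commute[of y x] inner_diff_left)
qed

lemma reg_grad_lipschitz: "norm (reg_grad z x - reg_grad z y) \<le> 3 * L * norm (x - y)"
proof -
  have "norm (reg_grad z x - reg_grad z y)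
      = norm ((grad f x - grad f y) + (2 * \<sigma>) *\<^sub>R (x - y))"
    by (simp add: reg_grad_def algebra_simps)
  also have "\<dots> \<le> L * norm (x - y) + 2 * \<sigma> * norm (x - y)"
    using norm_triangle_le grad_f_lipschitz \<sigma>_pos by (smt (verit) norm_scaleR norm_triangle_ineq)
  also have "\<dots> \<le> 3 * L * norm (x - y)"
    using mult_right_mono[OF \<sigma>_le, of "norm (x - y)"] by simp
  finally show ?thesis .
qed

lemma center_subgradient: "subgradient (- reg_grad z (center z)) (center z)"
proof -
  have "\<exists>x. subgradient (- reg_grad z x) x"
    using ex_stationary_point[of \<sigma> "reg_grad z" "3 * L", OF \<sigma>_pos reg_grad_mono reg_grad_lipschitz]
      \<sigma>_pos \<sigma>_le by simp
  then show ?thesis unfolding center_def by (rule someI_ex)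
qed

lemma center_dom: "center z \<in> dom"
  using center_subgradient unfolding subgradient_def by blast

lemma objective_center:
  assumes "u \<in> dom"
  shows "objective z (center z) + \<sigma> / 2 * (norm (u - center z))\<^sup>2 \<le> objective z u"
  using center_subgradient[of z] reg_lower[of z "center z" u] assms
  unfolding subgradient_def objective_def by (auto dest!: bspec)

text \<open>\<open>e\<close> stands for the mini batch error and \<open>\<zeta>\<close> for the
  noise of the drawn index. The noise has mean zero, so its product with the fixed
  \<open>x - c\<close> is kept. The error does not average out, so Young's inequality charges it to
  \<open>\<sigma> / 2\<close> of the new squared distance; strong convexity saves as much on the old
  one, which leaves equal coefficients on both sides.\<close>

lemma prox_step_objective_bound:
  fixes g x z e :: 'a and \<alpha> :: real
  defines "y \<equiv> prox_step \<psi> \<alpha> g x" and "\<zeta> \<equiv> g - reg_grad z x - e" and "c \<equiv> center z"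
  assumes \<alpha>: "0 < \<alpha>" "6 * \<alpha> * L \<le> 1"
  shows "objective z y - objective z c + (1 / (2 * \<alpha>) - \<sigma> / 2) * (norm (y - c))\<^sup>2
    \<le> (1 / (2 * \<alpha>) - \<sigma> / 2) * (norm (x - c))\<^sup>2 + (norm e)\<^sup>2 / (2 * \<sigma>)
      + \<alpha> * (norm \<zeta>)\<^sup>2 - \<zeta> \<bullet> (x - c)"
proof -
  let ?G = "reg_grad z x"
  define a where "a = 1 / (2 * \<alpha>)"
  have "val y + ((1 / \<alpha>) *\<^sub>R (x - y) - g) \<bullet> (c - y) \<le> val c"
    using prox_step_subgradient[OF \<alpha>(1), of x g] center_dom
    unfolding subgradient_def y_def c_def by blast
  moreover have "reg z y \<le> reg z x + ?G \<bullet> (y - x) + 3 * L / 2 * (norm (y - x))\<^sup>2"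
    by (rule reg_upper)
  moreover have "reg z c \<ge> reg z x + ?G \<bullet> (c - x) + \<sigma> / 2 * (norm (x - c))\<^sup>2"
    by (metis norm_minus_commute reg_lower)
  moreover have "((1 / \<alpha>) *\<^sub>R (x - y) - g) \<bullet> (c - y)
      = a * (norm (y - c))\<^sup>2 + a * (norm (y - x))\<^sup>2 - a * (norm (x - c))\<^sup>2 - g \<bullet> (c - y)"
  proof -
    have "2 * ((x - y) \<bullet> (c - y)) = (norm (y - c))\<^sup>2 + (norm (y - x))\<^sup>2 - (norm (x - c))\<^sup>2"
      unfolding power2_norm_eq_inner by (simp add: inner_diff_left inner_diff_right inner_commute)
    moreover have "((1 / \<alpha>) *\<^sub>R (x - y) - g) \<bullet> (c - y) = a * (2 * ((x - y) \<bullet> (c - y))) - g \<bullet> (c - y)"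
      by (simp add: a_def inner_diff_left[of "(1 / \<alpha>) *\<^sub>R (x - y)"])
    ultimately show ?thesis by (simp add: distrib_left right_diff_distrib)
  qed
  moreover have "?G \<bullet> (y - x) - ?G \<bullet> (c - x) + g \<bullet> (c - y)
      = (- \<zeta>) \<bullet> (y - x) - \<zeta> \<bullet> (x - c) + (- e) \<bullet> (y - c)"
    unfolding \<zeta>_def by (simp add: inner_diff_left inner_diff_right algebra_simps)
  moreover have "(- \<zeta>) \<bullet> (y - x) \<le> \<alpha> * (norm \<zeta>)\<^sup>2 + a / 2 * (norm (y - x))\<^sup>2"
    using inner_le_weighted_norms[OF \<alpha>(1), of "- \<zeta>" "y - x"] by (simp add: a_def)
  moreover have "(- e) \<bullet> (y - c) \<le> (norm e)\<^sup>2 / (2 * \<sigma>) + \<sigma> / 2 * (norm (y - c))\<^sup>2"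
    using inner_le_weighted_norms[of "1 / (2 * \<sigma>)" "- e" "y - c"] \<sigma>_pos by (simp add: field_simps)
  \<comment> \<open>The proximal term \<open>a * (norm (y - x))\<^sup>2\<close> is split evenly: one
    half absorbs the noise, the other the smoothness term, which is the origin of 6\<alpha>L \<le>
    1.\<close>
  moreover have "3 * L / 2 * (norm (y - x))\<^sup>2 \<le> a / 2 * (norm (y - x))\<^sup>2"
  proof (rule mult_right_mono)
    show "3 * L / 2 \<le> a / 2" using \<alpha> by (simp add: a_def field_simps)
  qed simp
  ultimately show ?thesis unfolding objective_def a_def[symmetric] left_diff_distrib by linarith
qed

text \<open>The estimator has mean \<open>reg_grad z x + e\<close>, so the linear noise term
  vanishes on average, and smoothness of each component bounds the variance by the squared distance
  to the snapshot.\<close>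

lemma natasha_step_expectation:
  fixes x z xt \<mu> :: 'a and \<alpha> :: real
  defines "c \<equiv> center z" and "\<beta> \<equiv> 1 / (2 * \<alpha>) - \<sigma> / 2"
  assumes \<alpha>: "0 < \<alpha>" "6 * \<alpha> * L \<le> 1"
  shows "measure_pmf.expectation (pmf_of_set {1..n})
      (\<lambda>i. objective z (natasha_step fs \<psi> \<sigma> \<alpha> xt \<mu> z i x) - objective z c
        + \<beta> * (norm (natasha_step fs \<psi> \<sigma> \<alpha> xt \<mu> z i x - c))\<^sup>2)
    \<le> \<beta> * (norm (x - c))\<^sup>2 + \<alpha> * L\<^sup>2 * (norm (x - xt))\<^sup>2 + (norm (\<mu> - grad f xt))\<^sup>2 / (2 * \<sigma>)"
    (is "measure_pmf.expectation _ ?h \<le> _")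
proof -
  define e where "e = \<mu> - grad f xt"
  define a where "a i = grad (fs i) x - grad (fs i) xt" for i
  define \<zeta> where "\<zeta> i = a i - (1 / real n) *\<^sub>R sum a {1..n}" for i
  let ?b = "\<beta> * (norm (x - c))\<^sup>2 + (norm e)\<^sup>2 / (2 * \<sigma>)"
  have mean: "(1 / real n) *\<^sub>R sum a {1..n} = grad f x - grad f xt"
    by (simp add: a_def grad_f sum_subtractf scaleR_diff_right)
  have "?h i \<le> ?b + \<alpha> * (norm (\<zeta> i))\<^sup>2 - \<zeta> i \<bullet> (x - c)" for i
  proof -
    let ?g = "grad (fs i) x - grad (fs i) xt + \<mu> + (2 * \<sigma>) *\<^sub>R (x - z)"
    have "?g - reg_grad z x - e = \<zeta> i"
      unfolding \<zeta>_def mean by (simp add: a_def reg_grad_def e_def)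
    then show ?thesis
      using prox_step_objective_bound[OF \<alpha>, of z ?g x e]
      unfolding natasha_step_def c_def \<beta>_def by simp
  qed
  then have "(\<Sum>i=1..n. ?h i) \<le> (\<Sum>i=1..n. ?b + \<alpha> * (norm (\<zeta> i))\<^sup>2 - \<zeta> i \<bullet> (x - c))"
    by (intro sum_mono)
  also have "\<dots> = real n * ?b + \<alpha> * (\<Sum>i=1..n. (norm (\<zeta> i))\<^sup>2) - (\<Sum>i=1..n. \<zeta> i) \<bullet> (x - c)"
    by (simp add: sum.distrib sum_subtractf sum_distrib_left inner_sum_left)
  also have "(\<Sum>i=1..n. \<zeta> i) = 0"
    using n by (simp add: \<zeta>_def sum_subtractf sum_constant_scaleR)
  also have "(\<Sum>i=1..n. (norm (\<zeta> i))\<^sup>2) \<le> (\<Sum>i=1..n. (norm (a i))\<^sup>2)"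
    unfolding \<zeta>_def using sum_norm_deviation_le[of "{1..n}" a] by simp
  also have "\<dots> \<le> (\<Sum>i=1..n. (L * norm (x - xt))\<^sup>2)"
    using smooth unfolding a_def smooth_def by (intro sum_mono power_mono) auto
  finally have "(\<Sum>i=1..n. ?h i) \<le> real n * (?b + \<alpha> * L\<^sup>2 * (norm (x - xt))\<^sup>2)"
    using \<alpha>(1) by (simp add: power_mult_distrib algebra_simps)
  moreover have "s / real n \<le> t" if "s \<le> real n * t" for s t
    using that n by (simp add: divide_le_eq mult.commute)
  ultimately have "(\<Sum>i=1..n. ?h i) / real n \<le> ?b + \<alpha> * L\<^sup>2 * (norm (x - xt))\<^sup>2"
    by blast
  moreover have "measure_pmf.expectation (pmf_of_set {1..n}) ?h = (\<Sum>i=1..n. ?h i) / real n"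
    using n by (subst integral_pmf_of_set) auto
  ultimately show ?thesis unfolding e_def by linarith
qed

end

section \<open>Sub-epochs\<close>

lemma card_subsets_including:
  assumes "finite A" "I \<subseteq> A" "card I \<le> B"
  shows "card {S. S \<subseteq> A \<and> card S = B \<and> I \<subseteq> S} = (card A - card I) choose (B - card I)"
proof -
  have I: "finite I" using assms finite_subset by blast
  have "bij_betw (\<lambda>S. S - I) {S. S \<subseteq> A \<and> card S = B \<and> I \<subseteq> S}
      {S. S \<subseteq> A - I \<and> card S = B - card I}"
  proof (rule bij_betw_byWitness[where f' = "\<lambda>S. S \<union> I"])
    have "card (S \<union> I) = B" if "S \<subseteq> A - I" "card S = B - card I" for S
    proof -
      have "finite S" using that(1) assms(1) finite_subset by blast
      then show ?thesis using that I assms(3) by (subst card_Un_disjoint) auto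
    qed
    then show "(\<lambda>S. S \<union> I) ` {S. S \<subseteq> A - I \<and> card S = B - card I}
        \<subseteq> {S. S \<subseteq> A \<and> card S = B \<and> I \<subseteq> S}"
      using assms(2) by auto
  qed (use I in \<open>auto simp: card_Diff_subset\<close>)
  then have "card {S. S \<subseteq> A \<and> card S = B \<and> I \<subseteq> S} = card {S. S \<subseteq> A - I \<and> card S = B - card I}"
    by (rule bij_betw_same_card)
  also have "\<dots> = (card A - card I) choose (B - card I)"
    using assms I by (simp add: n_subsets card_Diff_subset)
  finally show ?thesis .
qed

text \<open>Sampling without replacement is at least as good as sampling with replacement, because the
  pairs \<open>i \<noteq> j\<close> all occur equally often and \<open>v\<close> is centered.\<close>

lemma sum_subsets_norm_power2_le:
  fixes v :: "'i \<Rightarrow> 'a::real_inner"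
  assumes A: "finite A" "A \<noteq> {}" and B: "1 \<le> B" and v: "sum v A = 0"
  defines "\<S> \<equiv> {S. S \<subseteq> A \<and> card S = B}"
  shows "(\<Sum>S\<in>\<S>. (norm (sum v S))\<^sup>2) \<le> real (card \<S>) * (real B / real (card A)) * (\<Sum>i\<in>A. (norm (v i))\<^sup>2)"
proof -
  have fin: "finite \<S>" unfolding \<S>_def using A(1) by simp
  define N where "N i j = card {S \<in> \<S>. i \<in> S \<and> j \<in> S}" for i j
  define r where "r = (card A - 1) choose (B - 1)"
  \<comment> \<open>For \<open>B = 1\<close> truncated subtraction would make the binomial
    coefficient 1, although no batch contains two indices.\<close>
  define q where "q = (if 2 \<le> B then (card A - 2) choose (B - 2) else 0)"
  have diag: "N i i = r" if "i \<in> A" for i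
  proof -
    have "{S \<in> \<S>. i \<in> S \<and> i \<in> S} = {S. S \<subseteq> A \<and> card S = B \<and> {i} \<subseteq> S}"
      by (auto simp: \<S>_def)
    then show ?thesis using card_subsets_including[of A "{i}" B] A that B by (simp add: N_def r_def)
  qed
  have off: "N i j = q" if "i \<in> A" "j \<in> A" "i \<noteq> j" for i j
  proof (cases "2 \<le> B")
    case True
    have "{S \<in> \<S>. i \<in> S \<and> j \<in> S} = {S. S \<subseteq> A \<and> card S = B \<and> {i, j} \<subseteq> S}"
      by (auto simp: \<S>_def)
    then show ?thesis using card_subsets_including[of A "{i, j}" B] A that True
      by (simp add: N_def q_def flip: numeral_2_eq_2)
  next
    case False
    then have "B = 1" using B by simp
    then have "{S \<in> \<S>. i \<in> S \<and> j \<in> S} = {}"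
      using that(3) by (auto simp: \<S>_def card_1_singleton_iff)
    then show ?thesis using False by (simp only: N_def q_def) simp
  qed
  \<comment> \<open>Double counting of the pairs of an index and a batch containing it.\<close>
  have "real (card A) * real r = (\<Sum>i\<in>A. real (N i i))" by (simp add: diag)
  also have "\<dots> = (\<Sum>i\<in>A. \<Sum>S\<in>\<S>. if i \<in> S then 1 else 0)"
    by (intro sum.cong) (simp_all add: N_def sum.If_cases fin Int_def)
  also have "\<dots> = (\<Sum>S\<in>\<S>. \<Sum>i\<in>A. if i \<in> S then 1 else 0)" by (rule sum.swap)
  also have "\<dots> = (\<Sum>S\<in>\<S>. real B)"
  proof (rule sum.cong)
    fix S assume "S \<in> \<S>"
    then have "A \<inter> S = S" "card S = B" by (auto simp: \<S>_def)
    then show "(\<Sum>i\<in>A. if i \<in> S then 1 else 0) = real B"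
      using A(1) by (simp add: sum.If_cases Int_def)
  qed simp
  finally have "real (card A) * real r = real (card \<S>) * real B" by simp
  then have r: "real r = real (card \<S>) * (real B / real (card A))"
    using A by (simp add: field_simps card_gt_0_iff)
  have "(\<Sum>S\<in>\<S>. (norm (sum v S))\<^sup>2)
      = (\<Sum>S\<in>\<S>. \<Sum>i\<in>A. \<Sum>j\<in>A. if i \<in> S \<and> j \<in> S then v i \<bullet> v j else 0)"
  proof (rule sum.cong)
    fix S assume "S \<in> \<S>"
    then have S: "A \<inter> S = S" by (auto simp: \<S>_def)
    have "sum v S = (\<Sum>i\<in>A. if i \<in> S then v i else 0)"
      using A(1) S sum.inter_restrict[of A v S] by simp
    then have "(norm (sum v S))\<^sup>2
        = (\<Sum>i\<in>A. \<Sum>j\<in>A. (if i \<in> S then v i else 0) \<bullet> (if j \<in> S then v j else 0))"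
      by (simp only: power2_norm_eq_inner inner_sum_left inner_sum_right) (rule sum.swap)
    also have "\<dots> = (\<Sum>i\<in>A. \<Sum>j\<in>A. if i \<in> S \<and> j \<in> S then v i \<bullet> v j else 0)"
      by (intro sum.cong) auto
    finally show "(norm (sum v S))\<^sup>2 = (\<Sum>i\<in>A. \<Sum>j\<in>A. if i \<in> S \<and> j \<in> S then v i \<bullet> v j else 0)" .
  qed simp
  also have "\<dots> = (\<Sum>i\<in>A. \<Sum>S\<in>\<S>. \<Sum>j\<in>A. if i \<in> S \<and> j \<in> S then v i \<bullet> v j else 0)"
    by (rule sum.swap)
  also have "\<dots> = (\<Sum>i\<in>A. \<Sum>j\<in>A. \<Sum>S\<in>\<S>. if i \<in> S \<and> j \<in> S then v i \<bullet> v j else 0)"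
    by (intro sum.cong refl sum.swap)
  also have "\<dots> = (\<Sum>i\<in>A. \<Sum>j\<in>A. real (N i j) * (v i \<bullet> v j))"
    by (intro sum.cong refl) (simp add: N_def sum.If_cases fin Int_def)
  also have "\<dots> = (\<Sum>i\<in>A. \<Sum>j\<in>A. real q * (v i \<bullet> v j) + (if i = j then (real r - real q) * (norm (v i))\<^sup>2 else 0))"
    by (intro sum.cong refl) (auto simp: diag off power2_norm_eq_inner algebra_simps)
  also have "\<dots> = (\<Sum>i\<in>A. \<Sum>j\<in>A. real q * (v i \<bullet> v j)) + (real r - real q) * (\<Sum>i\<in>A. (norm (v i))\<^sup>2)"
    using A(1) by (simp add: sum.distrib sum.delta sum_distrib_left)
  also have "(\<Sum>i\<in>A. \<Sum>j\<in>A. real q * (v i \<bullet> v j)) = real q * (sum v A \<bullet> sum v A)"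
    by (simp add: inner_sum_left inner_sum_right sum_distrib_left inner_commute)
  also have "\<dots> = 0" by (simp add: v)
  \<comment> \<open>Using just \<open>q \<ge> 0\<close> gives up the finite population correction,
    so the bound is the one for sampling with replacement.\<close>
  also have "0 + (real r - real q) * (\<Sum>i\<in>A. (norm (v i))\<^sup>2) \<le> real r * (\<Sum>i\<in>A. (norm (v i))\<^sup>2)"
    by (simp add: mult_right_mono sum_nonneg)
  finally show ?thesis by (simp only: r)
qed

section \<open>Expectations over distributions with finite support\<close>

lemma expectation_bind_finite:
  fixes h :: "'b \<Rightarrow> real"
  assumes "finite (set_pmf p)" "\<And>x. x \<in> set_pmf p \<Longrightarrow> finite (set_pmf (g x))"
  shows "measure_pmf.expectation (bind_pmf p g) h
    = measure_pmf.expectation p (\<lambda>x. measure_pmf.expectation (g x) h)"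
  using assms by (simp add: pmf_expectation_bind[OF assms(1)] integral_measure_pmf[OF assms(1)])

lemma expectation_mono_finite:
  fixes g h :: "'b \<Rightarrow> real"
  assumes "finite (set_pmf p)" "\<And>x. x \<in> set_pmf p \<Longrightarrow> g x \<le> h x"
  shows "measure_pmf.expectation p g \<le> measure_pmf.expectation p h"
  using assms
  by (intro integral_mono_AE) (auto simp: AE_measure_pmf_iff intro: integrable_measure_pmf_finite)

lemma expectation_bind_le:
  fixes h :: "'b \<Rightarrow> real"
  assumes "finite (set_pmf p)" "\<And>x. x \<in> set_pmf p \<Longrightarrow> finite (set_pmf (g x))"
    and "\<And>x. x \<in> set_pmf p \<Longrightarrow> measure_pmf.expectation (g x) h \<le> k x"
  shows "measure_pmf.expectation (bind_pmf p g) h \<le> measure_pmf.expectation p k"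
  using assms by (simp add: expectation_bind_finite expectation_mono_finite)

lemma expectation_const_add:
  fixes h :: "'b \<Rightarrow> real"
  assumes "finite (set_pmf p)"
  shows "measure_pmf.expectation p (\<lambda>x. c + h x) = c + measure_pmf.expectation p h"
  using assms by (simp add: integrable_measure_pmf_finite)

lemma set_pmf_uniform_entry: "xs \<noteq> [] \<Longrightarrow> set_pmf (uniform_entry xs) = set xs"
  unfolding uniform_entry_def
  by (subst set_map_pmf, subst set_pmf_of_set) (auto simp: set_conv_nth)

lemma expectation_uniform_entry:
  fixes h :: "'b \<Rightarrow> real"
  assumes "xs \<noteq> []"
  shows "measure_pmf.expectation (uniform_entry xs) h = (\<Sum>x\<leftarrow>xs. h x) / real (length xs)"
  unfolding uniform_entry_def using assms
  by (simp add: integral_pmf_of_set lessThan_empty_iff sum_list_sum_nth atLeast0LessThan)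

section \<open>The inner loop\<close>

context composite_problem
begin

abbreviation "F x \<equiv> val x + f x"

abbreviation "residual z \<equiv> (norm (z - center z))\<^sup>2"

lemma objective_eq: "objective z x = F x + \<sigma> * (norm (x - z))\<^sup>2"
  by (simp add: objective_def reg_def)

lemma set_pmf_index: "set_pmf (pmf_of_set {Suc 0..n}) = {Suc 0..n}"
  using n by (subst set_pmf_of_set) auto

lemma inner_loop_Suc:
  "inner_loop n fs \<psi> \<sigma> \<alpha> xt \<mu> z (Suc k) x =
    bind_pmf (pmf_of_set {1..n}) (\<lambda>i. map_pmf (\<lambda>(xs, c). (x # xs, 2 + c))
      (inner_loop n fs \<psi> \<sigma> \<alpha> xt \<mu> z k (natasha_step fs \<psi> \<sigma> \<alpha> xt \<mu> z i x)))"
  by (simp add: map_pmf_def split_def)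

lemma finite_inner_loop: "finite (set_pmf (inner_loop n fs \<psi> \<sigma> \<alpha> xt \<mu> z k x))"
  by (induction k arbitrary: x) (auto simp: inner_loop_Suc set_pmf_index simp del: inner_loop.simps(2))

lemma natasha_step_dom: "0 < \<alpha> \<Longrightarrow> natasha_step fs \<psi> \<sigma> \<alpha> xt \<mu> z i x \<in> dom"
  unfolding natasha_step_def by (rule prox_step_dom)

lemma inner_loop_support:
  assumes "0 < \<alpha>" "x \<in> dom" "(xs, c) \<in> set_pmf (inner_loop n fs \<psi> \<sigma> \<alpha> xt \<mu> z k x)"
  shows "length xs = k \<and> set xs \<subseteq> dom \<and> c = 2 * k"
  using assms(2,3)
proof (induction k arbitrary: x xs c)
  case (Suc k)
  then obtain i ys d where "xs = x # ys" "c = 2 + d"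
    "(ys, d) \<in> set_pmf (inner_loop n fs \<psi> \<sigma> \<alpha> xt \<mu> z k (natasha_step fs \<psi> \<sigma> \<alpha> xt \<mu> z i x))"
    unfolding inner_loop_Suc by auto
  with Suc.IH[OF natasha_step_dom[OF assms(1)] this(3)] Suc.prems(1) show ?case by simp
qed simp

text \<open>The list records an iterate before its step, while the step inequality bounds the value
  after it. Hence the value at the start appears on the right, and that of the last, unrecorded
  iterate is dropped. Each summand subtracts the variance of its own step, so only the distance to
  \<open>c\<close> has to telescope.\<close>

lemma inner_loop_expectation:
  fixes z xt \<mu> x :: 'a and \<alpha> :: real
  defines "c \<equiv> center z" and "\<beta> \<equiv> 1 / (2 * \<alpha>) - \<sigma> / 2"
  defines "b \<equiv> (norm (\<mu> - grad f xt))\<^sup>2 / (2 * \<sigma>)"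
  assumes \<alpha>: "0 < \<alpha>" "6 * \<alpha> * L \<le> 1" and "x \<in> dom"
  shows "measure_pmf.expectation (inner_loop n fs \<psi> \<sigma> \<alpha> xt \<mu> z k x)
      (\<lambda>(xs, _). \<Sum>y\<leftarrow>xs. objective z y - objective z c - \<alpha> * L\<^sup>2 * (norm (y - xt))\<^sup>2)
    \<le> objective z x - objective z c + \<beta> * (norm (x - c))\<^sup>2 + real k * b"
  using \<open>x \<in> dom\<close>
proof (induction k arbitrary: x)
  case 0
  \<comment> \<open>What is left of the potential after the last step has to be nonnegative, for
    which the step size must be short.\<close>
  have "3 * L \<le> 1 / (2 * \<alpha>)" using \<alpha> by (simp add: field_simps)
  then have "0 \<le> \<beta>" unfolding \<beta>_def using \<sigma>_pos \<sigma>_le by linarith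
  moreover have "objective z c + \<sigma> / 2 * (norm (x - c))\<^sup>2 \<le> objective z x"
    unfolding c_def by (rule objective_center[OF 0])
  moreover have "0 \<le> \<sigma> / 2 * (norm (x - c))\<^sup>2" using \<sigma>_pos by simp
  ultimately show ?case by simp
next
  case (Suc k)
  let ?w = "\<lambda>y. objective z y - objective z c - \<alpha> * L\<^sup>2 * (norm (y - xt))\<^sup>2"
  let ?h = "\<lambda>(xs :: 'a list, _ :: nat). \<Sum>y\<leftarrow>xs. ?w y"
  let ?s = "\<lambda>i. natasha_step fs \<psi> \<sigma> \<alpha> xt \<mu> z i x"
  let ?I = "pmf_of_set {1..n}"
  let ?P = "\<lambda>y. objective z y - objective z c + \<beta> * (norm (y - c))\<^sup>2"
  have "measure_pmf.expectation (inner_loop n fs \<psi> \<sigma> \<alpha> xt \<mu> z (Suc k) x) ?h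
      \<le> measure_pmf.expectation ?I (\<lambda>i. (?w x + real k * b) + ?P (?s i))"
    unfolding inner_loop_Suc
  proof (rule expectation_bind_le)
    fix i
    let ?J = "inner_loop n fs \<psi> \<sigma> \<alpha> xt \<mu> z k (?s i)"
    have "measure_pmf.expectation (map_pmf (\<lambda>(xs, c). (x # xs, 2 + c)) ?J) ?h
        = measure_pmf.expectation ?J (\<lambda>y. ?w x + ?h y)"
      by (simp add: split_def)
    also have "\<dots> = ?w x + measure_pmf.expectation ?J ?h"
      by (rule expectation_const_add[OF finite_inner_loop])
    also have "\<dots> \<le> ?w x + (?P (?s i) + real k * b)"
      using Suc.IH[OF natasha_step_dom[OF \<alpha>(1)]] by (rule add_left_mono)
    finally show "measure_pmf.expectation (map_pmf (\<lambda>(xs, c). (x # xs, 2 + c)) ?J) ?h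
        \<le> (?w x + real k * b) + ?P (?s i)" by linarith
  qed (auto simp: set_pmf_index finite_inner_loop)
  also have "\<dots> = (?w x + real k * b) + measure_pmf.expectation ?I (\<lambda>i. ?P (?s i))"
    by (rule expectation_const_add) (simp add: set_pmf_index)
  also have "\<dots> \<le> (?w x + real k * b)
      + (\<beta> * (norm (x - c))\<^sup>2 + \<alpha> * L\<^sup>2 * (norm (x - xt))\<^sup>2 + b)"
    unfolding c_def \<beta>_def b_def by (intro add_left_mono natasha_step_expectation \<alpha>)
  also have "\<dots> = ?P x + real (Suc k) * b" by (simp add: algebra_simps)
  finally show ?case by simp
qed

text \<open>Averaged over the loop, the starting point costs at most \<open>?Q / 4\<close> and
  \<open>\<sigma> / 8 * ?D\<close>, by the two bounds on \<open>m\<close>. Strong convexity gives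
  \<open>\<sigma> / 2 * ?D \<le> ?Q\<close>, so the remaining three quarters of the gap
  \<open>?Q\<close> are worth 3/8 of \<sigma> times \<open>?D\<close>, and 3/8 - 1/8 = 1/4.\<close>

lemma inner_loop_descent:
  fixes z xt \<mu> :: 'a and \<alpha> :: real
  defines "b \<equiv> (norm (\<mu> - grad f xt))\<^sup>2 / (2 * \<sigma>)"
  assumes \<alpha>: "0 < \<alpha>" "6 * \<alpha> * L \<le> 1" and z: "z \<in> dom" and m: "4 \<le> m" "4 / \<sigma> \<le> \<alpha> * real m"
  shows "measure_pmf.expectation (inner_loop n fs \<psi> \<sigma> \<alpha> xt \<mu> z m z)
      (\<lambda>(xs, _). (\<Sum>y\<leftarrow>xs. F y + \<sigma> * (norm (y - z))\<^sup>2 - \<alpha> * L\<^sup>2 * (norm (y - xt))\<^sup>2) / real m)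
    \<le> F z - \<sigma> / 4 * residual z + b"
proof -
  let ?J = "inner_loop n fs \<psi> \<sigma> \<alpha> xt \<mu> z m z"
  let ?H = "objective z (center z)" and ?D = "residual z"
  let ?Q = "F z - ?H"
  let ?w = "\<lambda>y. objective z y - \<alpha> * L\<^sup>2 * (norm (y - xt))\<^sup>2"
  let ?h = "\<lambda>(xs :: 'a list, _ :: nat). \<Sum>y\<leftarrow>xs. objective z y - ?H - \<alpha> * L\<^sup>2 * (norm (y - xt))\<^sup>2"
  have m0: "real m > 0" using m by simp
  have "measure_pmf.expectation ?J (\<lambda>(xs, _). (\<Sum>y\<leftarrow>xs. ?w y) / real m)
      = measure_pmf.expectation ?J (\<lambda>y. ?H + ?h y / real m)"
  proof (intro integral_cong_AE)
    have *: "(\<Sum>y\<leftarrow>xs. objective z y - ?H - \<alpha> * L\<^sup>2 * (norm (y - xt))\<^sup>2)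
        = (\<Sum>y\<leftarrow>xs. ?w y) - real (length xs) * ?H" for xs
      by (induction xs) (simp_all add: algebra_simps)
    show "AE y in ?J. (case y of (xs, _) \<Rightarrow> (\<Sum>y\<leftarrow>xs. ?w y) / real m) = ?H + ?h y / real m"
    proof (rule AE_pmfI)
      fix y assume "y \<in> set_pmf ?J"
      moreover obtain xs c where y: "y = (xs, c)" by (cases y)
      ultimately have "length xs = m" using inner_loop_support[OF \<alpha>(1) z] by blast
      then show "(case y of (xs, _) \<Rightarrow> (\<Sum>y\<leftarrow>xs. ?w y) / real m) = ?H + ?h y / real m"
        using m0 by (simp add: y * diff_divide_distrib)
    qed
  qed auto
  also have "\<dots> = ?H + measure_pmf.expectation ?J ?h / real m"
    by (simp add: expectation_const_add finite_inner_loop)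
  also have "\<dots> \<le> ?H + (?Q + (1 / (2 * \<alpha>) - \<sigma> / 2) * ?D + real m * b) / real m"
    using inner_loop_expectation[OF \<alpha> z, of xt \<mu> z m] m0
    unfolding b_def objective_eq[of z z] by (intro add_left_mono divide_right_mono) auto
  also have "\<dots> = ?H + ?Q / real m + (1 / (2 * \<alpha> * real m)) * ?D - \<sigma> / 2 * ?D / real m + b"
    using m0 \<alpha>(1) by (simp add: field_simps)
  also have "\<dots> \<le> ?H + ?Q / 4 + \<sigma> / 8 * ?D + b"
  proof -
    have Q: "\<sigma> / 2 * ?D \<le> ?Q"
      using objective_center[OF z, of z] by (simp add: objective_eq[of z z])
    then have "?Q - \<sigma> / 2 * ?D \<ge> 0" by simp
    then have "(?Q - \<sigma> / 2 * ?D) / real m \<le> (?Q - \<sigma> / 2 * ?D) / 4"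
      using m by (intro divide_left_mono) auto
    moreover have "0 \<le> \<sigma> / 2 * ?D" using \<sigma>_pos by simp
    moreover have "1 / (2 * \<alpha> * real m) * ?D \<le> \<sigma> / 8 * ?D"
    proof (rule mult_right_mono)
      show "1 / (2 * \<alpha> * real m) \<le> \<sigma> / 8" using m(2) m0 \<alpha>(1) \<sigma>_pos by (simp add: field_simps)
    qed simp
    ultimately show ?thesis by (simp add: diff_divide_distrib)
  qed
  also have "\<dots> \<le> F z - \<sigma> / 4 * ?D + b"
  proof -
    have "\<sigma> / 2 * ?D \<le> ?Q"
      using objective_center[OF z, of z] by (simp add: objective_eq[of z z])
    then show ?thesis by (simp add: field_simps)
  qed
  finally show ?thesis unfolding objective_eq .
qed

end

lemma norm_add_power2_le:
  fixes u v :: "'a::real_inner"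
  assumes "q > 0"
  shows "(norm (u + v))\<^sup>2 \<le> (1 + 1 / q) * (norm u)\<^sup>2 + (1 + q) * (norm v)\<^sup>2"
proof -
  have "(norm (u + v))\<^sup>2 = (norm u)\<^sup>2 + 2 * (v \<bullet> u) + (norm v)\<^sup>2"
    unfolding power2_norm_eq_inner by (simp add: inner_add_left inner_add_right inner_commute)
  moreover have "2 * (v \<bullet> u) \<le> q * (norm v)\<^sup>2 + (norm u)\<^sup>2 / q"
    using inner_le_weighted_norms[of "q / 2" v u] assms by (simp add: field_simps)
  ultimately show ?thesis by (simp add: algebra_simps)
qed

context composite_problem
begin

lemma minibatch_expectation:
  assumes B: "1 \<le> B" "B \<le> n"
  shows "measure_pmf.expectation (pmf_of_set {S. S \<subseteq> {1..n} \<and> card S = B})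
      (\<lambda>S. (norm ((1 / real B) *\<^sub>R (\<Sum>i\<in>S. grad (fs i) x) - grad f x))\<^sup>2)
    \<le> gradient_variance n fs x / real B"
proof -
  let ?\<S> = "{S. S \<subseteq> {1..n} \<and> card S = B}"
  define v where "v i = grad (fs i) x - grad f x" for i
  have fin: "finite ?\<S>" by simp
  have ne: "?\<S> \<noteq> {}" using B by (metis (mono_tags, lifting) card_atLeastAtMost diff_Suc_1 empty_iff
        mem_Collect_eq obtain_subset_with_card_n)
  have v: "sum v {1..n} = 0"
    using n by (simp add: v_def sum_subtractf sum_constant_scaleR grad_f)
  have gv: "gradient_variance n fs x = (\<Sum>i=1..n. (norm (v i))\<^sup>2) / real n"
    using n by (simp add: gradient_variance_def integral_pmf_of_set v_def norm_minus_commute)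
  have "(\<Sum>S\<in>?\<S>. (norm ((1 / real B) *\<^sub>R (\<Sum>i\<in>S. grad (fs i) x) - grad f x))\<^sup>2)
      = (\<Sum>S\<in>?\<S>. (norm (sum v S))\<^sup>2 / (real B)\<^sup>2)"
  proof (rule sum.cong)
    fix S assume "S \<in> ?\<S>"
    then have "(1 / real B) *\<^sub>R (\<Sum>i\<in>S. grad (fs i) x) - grad f x = (1 / real B) *\<^sub>R sum v S"
      using B by (simp add: v_def sum_subtractf sum_constant_scaleR scaleR_diff_right)
    then show "(norm ((1 / real B) *\<^sub>R (\<Sum>i\<in>S. grad (fs i) x) - grad f x))\<^sup>2
        = (norm (sum v S))\<^sup>2 / (real B)\<^sup>2"
      by (simp add: power_divide)
  qed simp
  also have "\<dots> = (\<Sum>S\<in>?\<S>. (norm (sum v S))\<^sup>2) / (real B)\<^sup>2" by (simp add: sum_divide_distrib)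
  also have "\<dots> \<le> (real (card ?\<S>) * (real B / real (card {1..n})) * (\<Sum>i=1..n. (norm (v i))\<^sup>2)) / (real B)\<^sup>2"
    using n B v by (intro divide_right_mono sum_subsets_norm_power2_le) auto
  also have "\<dots> = real (card ?\<S>) * (gradient_variance n fs x / real B)"
    using B by (simp add: gv power2_eq_square)
  finally have "(\<Sum>S\<in>?\<S>. (norm ((1 / real B) *\<^sub>R (\<Sum>i\<in>S. grad (fs i) x) - grad f x))\<^sup>2)
      \<le> real (card ?\<S>) * (gradient_variance n fs x / real B)" .
  moreover have "real (card ?\<S>) > 0" using fin ne card_gt_0_iff of_nat_0_less_iff by blast
  ultimately show ?thesis
    by (subst integral_pmf_of_set[OF ne fin], subst pos_divide_le_eq) (simp_all only: mult.commute)
qed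

end

text \<open>The second bound on \<open>p\<close> lets the moves \<open>\<sigma> \<parallel>z' - z\<parallel>\<^sup>2\<close> pay for the distance to the snapshot over
  a whole epoch; the second bound on \<open>B div p\<close> makes the inner loop long enough to forget its
  starting point.\<close>

locale natasha_parameters = composite_problem +
  fixes \<alpha> :: real and B p :: nat
  assumes \<alpha>: "0 < \<alpha>" "6 * \<alpha> * L \<le> 1"
    and p: "1 \<le> p" "4 * (real p)\<^sup>2 * (\<alpha> * L\<^sup>2) \<le> \<sigma>"
    and m: "4 \<le> B div p" "4 / \<sigma> \<le> \<alpha> * real (B div p)"
    and B: "1 \<le> B" "B \<le> n"
begin

abbreviation "m \<equiv> B div p"

text \<open>With \<open>k\<close> sub-epochs to come the distance to the snapshot has weight
  \<open>2 * k\<close>, and the variance of the current one adds 1. Young's inequality with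
  parameter \<open>2 * k + 1\<close> raises this to exactly \<open>2 * (k + 1)\<close>, so the
  weight grows linearly; the price (2k + 1)(2k + 2) is at most \<open>4 * p\<^sup>2\<close>.\<close>

lemma drift_bound:
  fixes xt y z :: 'a
  assumes "k < p"
  shows "(2 * real k + 1) * (\<alpha> * L\<^sup>2) * (norm (y - xt))\<^sup>2
    \<le> \<sigma> * (norm (y - z))\<^sup>2 + 2 * (real k + 1) * (\<alpha> * L\<^sup>2) * (norm (z - xt))\<^sup>2"
proof -
  let ?q = "2 * real k + 1" and ?a = "\<alpha> * L\<^sup>2"
  have a: "0 \<le> ?a" using \<alpha>(1) by simp
  have "(norm (y - xt))\<^sup>2 = (norm ((z - xt) + (y - z)))\<^sup>2" by simp
  also have "\<dots> \<le> (1 + 1 / ?q) * (norm (z - xt))\<^sup>2 + (1 + ?q) * (norm (y - z))\<^sup>2"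
    by (rule norm_add_power2_le) simp
  finally have "?q * ?a * (norm (y - xt))\<^sup>2
      \<le> ?q * ?a * ((1 + 1 / ?q) * (norm (z - xt))\<^sup>2 + (1 + ?q) * (norm (y - z))\<^sup>2)"
    using a by (intro mult_left_mono) auto
  also have "\<dots> = (?q * (1 + 1 / ?q)) * ?a * (norm (z - xt))\<^sup>2
      + (?q * (1 + ?q) * ?a) * (norm (y - z))\<^sup>2"
    by (subst distrib_left) (simp only: mult.assoc mult.left_commute mult.commute)
  also have "?q * (1 + 1 / ?q) = 2 * (real k + 1)" by (simp add: field_simps)
  also have "?q * (1 + ?q) * ?a \<le> \<sigma>"
  proof -
    have "?q * (1 + ?q) \<le> (2 * real p) * (2 * real p)"
      using assms by (intro mult_mono) auto
    then have "?q * (1 + ?q) * ?a \<le> (2 * real p) * (2 * real p) * ?a"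
      using a by (rule mult_right_mono)
    also have "\<dots> = 4 * (real p)\<^sup>2 * ?a" by (simp add: power2_eq_square)
    finally show ?thesis using p(2) by linarith
  qed
  finally show ?thesis by (simp add: mult_right_mono)
qed

section \<open>Sub-epochs sharing one snapshot\<close>

lemma sub_epochs_Suc:
  "sub_epochs n fs \<psi> \<sigma> \<alpha> m xt \<mu> (Suc k) z =
    bind_pmf (inner_loop n fs \<psi> \<sigma> \<alpha> xt \<mu> z m z) (\<lambda>(xs, c).
      bind_pmf (uniform_entry xs) (\<lambda>z'.
        map_pmf (\<lambda>((X, y), c'). ((z # X, y), c + c')) (sub_epochs n fs \<psi> \<sigma> \<alpha> m xt \<mu> k z')))"
  by (simp add: map_pmf_def split_def)

text \<open>Nonemptiness is what gives \<open>uniform_entry\<close> a meaning, as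
  \<open>pmf_of_set {}\<close> is unspecified.\<close>

lemma inner_loop_entries:
  assumes "z \<in> dom" "(xs, c) \<in> set_pmf (inner_loop n fs \<psi> \<sigma> \<alpha> xt \<mu> z m z)"
  shows "xs \<noteq> []" "length xs = m" "set_pmf (uniform_entry xs) \<subseteq> dom" "c = 2 * m"
proof -
  note * = inner_loop_support[OF \<alpha>(1) assms]
  then show "xs \<noteq> []" using m(1) by auto
  with * show "length xs = m" "set_pmf (uniform_entry xs) \<subseteq> dom" "c = 2 * m"
    by (simp_all add: set_pmf_uniform_entry)
qed

lemma finite_sub_epochs:
  "z \<in> dom \<Longrightarrow> finite (set_pmf (sub_epochs n fs \<psi> \<sigma> \<alpha> m xt \<mu> k z))"
proof (induction k arbitrary: z)
  case (Suc k)
  show ?case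
    unfolding sub_epochs_Suc set_bind_pmf
  proof (rule finite_UN_I[OF finite_inner_loop], clarify)
    fix xs c assume "(xs, c) \<in> set_pmf (inner_loop n fs \<psi> \<sigma> \<alpha> xt \<mu> z m z)"
    note xs = inner_loop_entries[OF Suc.prems this]
    show "finite (set_pmf (bind_pmf (uniform_entry xs) (\<lambda>z'.
        map_pmf (\<lambda>((X, y), c'). ((z # X, y), c + c')) (sub_epochs n fs \<psi> \<sigma> \<alpha> m xt \<mu> k z'))))"
      using xs Suc.IH by (auto simp: set_pmf_uniform_entry intro!: finite_UN_I)
  qed
qed simp

lemma sub_epochs_support:
  assumes "z \<in> dom" "((X, y), c) \<in> set_pmf (sub_epochs n fs \<psi> \<sigma> \<alpha> m xt \<mu> k z)"
  shows "length X = k \<and> set X \<subseteq> dom \<and> y \<in> dom \<and> c = 2 * m * k"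
  using assms
proof (induction k arbitrary: z X y c)
  case (Suc k)
  then obtain xs d z' X' d' where xs: "(xs, d) \<in> set_pmf (inner_loop n fs \<psi> \<sigma> \<alpha> xt \<mu> z m z)"
    and z': "z' \<in> set_pmf (uniform_entry xs)"
    and sub: "((X', y), d') \<in> set_pmf (sub_epochs n fs \<psi> \<sigma> \<alpha> m xt \<mu> k z')"
    and eq: "X = z # X'" "c = d + d'"
    unfolding sub_epochs_Suc by auto
  note xs' = inner_loop_entries[OF Suc.prems(1) xs]
  from xs'(3) z' have "z' \<in> dom" by blast
  from Suc.IH[OF this sub] xs'(4) eq Suc.prems(1) show ?case by simp
qed simp

text \<open>\<open>k\<close> counts the sub-epochs still to come, and the weighted distance to the
  snapshot prepays their variance. At the start of an epoch \<open>z\<close> is the snapshot itself,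
  so this term vanishes.\<close>

lemma sub_epochs_expectation:
  fixes xt \<mu> z :: 'a
  defines "b \<equiv> (norm (\<mu> - grad f xt))\<^sup>2 / (2 * \<sigma>)"
  assumes "k \<le> p" "z \<in> dom"
  shows "measure_pmf.expectation (sub_epochs n fs \<psi> \<sigma> \<alpha> m xt \<mu> k z)
      (\<lambda>((X, y), _). F y + \<sigma> / 4 * (\<Sum>x\<leftarrow>X. residual x))
    \<le> F z + 2 * real k * (\<alpha> * L\<^sup>2) * (norm (z - xt))\<^sup>2 + real k * b"
  using assms(2,3)
proof (induction k arbitrary: z)
  case (Suc k)
  let ?a = "\<alpha> * L\<^sup>2"
  let ?h = "\<lambda>((X :: 'a list, y), _ :: nat). F y + \<sigma> / 4 * (\<Sum>x\<leftarrow>X. residual x)"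
  let ?sub = "\<lambda>k z. sub_epochs n fs \<psi> \<sigma> \<alpha> m xt \<mu> k z"
  let ?J = "inner_loop n fs \<psi> \<sigma> \<alpha> xt \<mu> z m z"
  let ?w = "\<lambda>y. F y + \<sigma> * (norm (y - z))\<^sup>2 - ?a * (norm (y - xt))\<^sup>2"
  let ?C = "\<sigma> / 4 * residual z + 2 * (real k + 1) * ?a * (norm (z - xt))\<^sup>2 + real k * b"
  let ?K = "\<lambda>(xs, _ :: nat). (\<Sum>y\<leftarrow>xs. ?w y) / real m"
  have "measure_pmf.expectation (?sub (Suc k) z) ?h \<le> measure_pmf.expectation ?J (\<lambda>y. ?C + ?K y)"
    unfolding sub_epochs_Suc
  proof (rule expectation_bind_le, goal_cases)
    case (3 y)
    obtain xs c where y: "y = (xs, c)" by (cases y)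
    note xs = inner_loop_entries[OF Suc.prems(2) 3[unfolded y]]
    let ?G = "\<lambda>z'. map_pmf (\<lambda>((X, y), c'). ((z # X, y), c + c')) (?sub k z')"
    have "measure_pmf.expectation (bind_pmf (uniform_entry xs) ?G) ?h
        \<le> measure_pmf.expectation (uniform_entry xs) (\<lambda>z'. ?C + ?w z')"
    proof (rule expectation_bind_le)
      fix z' assume "z' \<in> set_pmf (uniform_entry xs)"
      with xs have z': "z' \<in> dom" by blast
      then show "finite (set_pmf (?G z'))" by (simp add: finite_sub_epochs)
      have "measure_pmf.expectation (?G z') ?h
          = measure_pmf.expectation (?sub k z') (\<lambda>y. \<sigma> / 4 * residual z + ?h y)"
        by (simp add: split_def algebra_simps add_divide_distrib)
      also have "\<dots> = \<sigma> / 4 * residual z + measure_pmf.expectation (?sub k z') ?h"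
        by (rule expectation_const_add[OF finite_sub_epochs[OF z']])
      also have "\<dots> \<le> \<sigma> / 4 * residual z
          + (F z' + 2 * real k * ?a * (norm (z' - xt))\<^sup>2 + real k * b)"
        using Suc.IH[OF _ z'] Suc.prems(1) by (intro add_left_mono) simp
      also have "\<dots> \<le> ?C + ?w z'"
        using drift_bound[of k z' xt z] Suc.prems(1) by (simp add: distrib_right)
      finally show "measure_pmf.expectation (?G z') ?h \<le> ?C + ?w z'" .
    qed (simp add: set_pmf_uniform_entry xs)
    also have "\<dots> = ?C + measure_pmf.expectation (uniform_entry xs) ?w"
      by (rule expectation_const_add) (simp add: set_pmf_uniform_entry xs)
    also have "\<dots> = ?C + ?K y"
      by (simp add: expectation_uniform_entry xs(1,2) y)
    finally show ?case by (simp add: y)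
  next
    case (2 y)
    obtain xs c where y: "y = (xs, c)" by (cases y)
    note xs = inner_loop_entries[OF Suc.prems(2) 2[unfolded y]]
    then show ?case using finite_sub_epochs
      by (auto simp: y set_pmf_uniform_entry intro!: finite_UN_I)
  qed (rule finite_inner_loop)
  also have "\<dots> = ?C + measure_pmf.expectation ?J ?K"
    by (rule expectation_const_add[OF finite_inner_loop])
  also have "\<dots> \<le> ?C + (F z - \<sigma> / 4 * residual z + b)"
    unfolding b_def by (intro add_left_mono inner_loop_descent \<alpha> m Suc.prems)
  also have "\<dots> = F z + 2 * real (Suc k) * ?a * (norm (z - xt))\<^sup>2 + real (Suc k) * b"
    by (simp add: distrib_right)
  finally show ?case .
qed simp

section \<open>Epochs and the full run\<close>

definition minibatch_grad :: "nat set \<Rightarrow> 'a \<Rightarrow> 'a" where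
  "minibatch_grad S x = (1 / real B) *\<^sub>R (\<Sum>i\<in>S. grad (fs i) x)"

abbreviation "batches \<equiv> {S. S \<subseteq> {1..n} \<and> card S = B}"

lemma epochs_Suc:
  "epochs n fs \<psi> \<sigma> B p \<alpha> (Suc k) x =
    bind_pmf (pmf_of_set batches) (\<lambda>S.
      bind_pmf (sub_epochs n fs \<psi> \<sigma> \<alpha> m x (minibatch_grad S x) p x) (\<lambda>((X, y), c).
        map_pmf (\<lambda>((X', z), c'). ((X @ X', z), B + c + c')) (epochs n fs \<psi> \<sigma> B p \<alpha> k y)))"
  by (simp add: map_pmf_def split_def minibatch_grad_def)

lemma set_pmf_batches: "set_pmf (pmf_of_set batches) = batches"
proof (rule set_pmf_of_set)
  show "batches \<noteq> {}"
    using B by (metis (mono_tags, lifting) card_atLeastAtMost diff_Suc_1 empty_iff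
        mem_Collect_eq obtain_subset_with_card_n)
qed simp

lemma finite_batches: "finite (set_pmf (pmf_of_set batches))"
  by (simp only: set_pmf_batches) simp

lemma finite_epochs: "x \<in> dom \<Longrightarrow> finite (set_pmf (epochs n fs \<psi> \<sigma> B p \<alpha> k x))"
proof (induction k arbitrary: x)
  case (Suc k)
  then show ?case
    unfolding epochs_Suc set_bind_pmf
    by (intro finite_UN_I finite_batches finite_sub_epochs)
       (auto dest: sub_epochs_support[OF Suc.prems])
qed simp

lemma epochs_support:
  assumes "x \<in> dom" "((X, z), c) \<in> set_pmf (epochs n fs \<psi> \<sigma> B p \<alpha> k x)"
  shows "length X = k * p \<and> set X \<subseteq> dom \<and> z \<in> dom \<and> c = k * (B + 2 * m * p)"
  using assms
proof (induction k arbitrary: x X z c)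
  case (Suc k)
  then obtain S X1 y d X2 d' where sub: "((X1, y), d) \<in> set_pmf
        (sub_epochs n fs \<psi> \<sigma> \<alpha> m x (minibatch_grad S x) p x)"
    and rest: "((X2, z), d') \<in> set_pmf (epochs n fs \<psi> \<sigma> B p \<alpha> k y)"
    and eq: "X = X1 @ X2" "c = B + d + d'"
    unfolding epochs_Suc by auto
  note sub' = sub_epochs_support[OF Suc.prems(1) sub]
  then have "y \<in> dom" by simp
  from Suc.IH[OF this rest] sub' eq show ?case by (simp add: algebra_simps)
qed simp

text \<open>The bound for sub-epochs holds for an arbitrary vector \<open>\<mu>\<close>, so the
  batch is averaged only here, where the snapshot is fixed before the batch is drawn. All
  \<open>p\<close> sub-epochs share the batch, and its error is counted \<open>p\<close>
  times.\<close>

lemma epochs_expectation: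
  assumes V: "\<And>x. x \<in> dom \<Longrightarrow> gradient_variance n fs x \<le> V" and "x \<in> dom"
  shows "measure_pmf.expectation (epochs n fs \<psi> \<sigma> B p \<alpha> k x)
      (\<lambda>((X, y), _). F y + \<sigma> / 4 * (\<Sum>x\<leftarrow>X. residual x))
    \<le> F x + real (k * p) * (V / (2 * \<sigma> * real B))"
  using \<open>x \<in> dom\<close>
proof (induction k arbitrary: x)
  case (Suc k)
  let ?v = "V / (2 * \<sigma> * real B)"
  let ?h = "\<lambda>((X :: 'a list, y), _ :: nat). F y + \<sigma> / 4 * (\<Sum>x\<leftarrow>X. residual x)"
  let ?sub = "\<lambda>S. sub_epochs n fs \<psi> \<sigma> \<alpha> m x (minibatch_grad S x) p x"
  let ?C = "F x + real (k * p) * ?v"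
  let ?e = "\<lambda>S. (norm (minibatch_grad S x - grad f x))\<^sup>2"
  have "measure_pmf.expectation (epochs n fs \<psi> \<sigma> B p \<alpha> (Suc k) x) ?h
      \<le> measure_pmf.expectation (pmf_of_set batches) (\<lambda>S. ?C + real p / (2 * \<sigma>) * ?e S)"
    unfolding epochs_Suc
  proof (rule expectation_bind_le, goal_cases)
    case (2 S)
    show ?case
      unfolding set_bind_pmf
      by (intro finite_UN_I finite_sub_epochs Suc.prems)
         (auto dest: sub_epochs_support[OF Suc.prems] intro!: finite_imageI finite_epochs)
  next
    case (3 S)
    let ?G = "\<lambda>((X, y), c). map_pmf (\<lambda>((X', z), c'). ((X @ X', z), B + c + c'))
      (epochs n fs \<psi> \<sigma> B p \<alpha> k y)"
    have "measure_pmf.expectation (bind_pmf (?sub S) ?G) ?h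
        \<le> measure_pmf.expectation (?sub S) (\<lambda>y. real (k * p) * ?v + ?h y)"
    proof (rule expectation_bind_le)
      fix u assume "u \<in> set_pmf (?sub S)"
      moreover obtain X y c where u: "u = ((X, y), c)" by (metis surj_pair)
      ultimately have y: "y \<in> dom" using sub_epochs_support[OF Suc.prems] by blast
      then show "finite (set_pmf (?G u))" by (simp add: u finite_epochs)
      have "measure_pmf.expectation (?G u) ?h
          = measure_pmf.expectation (epochs n fs \<psi> \<sigma> B p \<alpha> k y)
              (\<lambda>y. \<sigma> / 4 * (\<Sum>x\<leftarrow>X. residual x) + ?h y)"
        by (simp add: u split_def algebra_simps add_divide_distrib)
      also have "\<dots> = \<sigma> / 4 * (\<Sum>x\<leftarrow>X. residual x)
          + measure_pmf.expectation (epochs n fs \<psi> \<sigma> B p \<alpha> k y) ?h"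
        by (rule expectation_const_add[OF finite_epochs[OF y]])
      also have "\<dots> \<le> \<sigma> / 4 * (\<Sum>x\<leftarrow>X. residual x) + (F y + real (k * p) * ?v)"
        by (rule add_left_mono[OF Suc.IH[OF y]])
      finally show "measure_pmf.expectation (?G u) ?h \<le> real (k * p) * ?v + ?h u"
        by (simp add: u)
    qed (rule finite_sub_epochs[OF Suc.prems])
    also have "\<dots> = real (k * p) * ?v + measure_pmf.expectation (?sub S) ?h"
      by (rule expectation_const_add[OF finite_sub_epochs[OF Suc.prems]])
    also have "\<dots> \<le> ?C + real p / (2 * \<sigma>) * ?e S"
      using sub_epochs_expectation[OF order.refl Suc.prems, of x "minibatch_grad S x"] by simp
    finally show ?case .
  qed (rule finite_batches)
  also have "\<dots> = ?C + real p / (2 * \<sigma>) * measure_pmf.expectation (pmf_of_set batches) ?e"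
    by (subst expectation_const_add[OF finite_batches]) simp
  also have "\<dots> \<le> ?C + real p / (2 * \<sigma>) * (V / real B)"
  proof (intro add_left_mono mult_left_mono)
    have "measure_pmf.expectation (pmf_of_set batches) ?e \<le> gradient_variance n fs x / real B"
      unfolding minibatch_grad_def by (rule minibatch_expectation[OF B])
    also have "\<dots> \<le> V / real B" using V[OF Suc.prems] by (simp add: divide_right_mono)
    finally show "measure_pmf.expectation (pmf_of_set batches) ?e \<le> V / real B" .
  qed (use \<sigma>_pos in simp)
  also have "\<dots> = F x + real (Suc k * p) * ?v"
    by (simp add: distrib_right add_divide_distrib)
  finally show ?case .
qed simp

lemma finite_natasha_full:
  assumes "x \<in> dom" "1 \<le> k"
  shows "finite (set_pmf (natasha_full n fs \<psi> \<sigma> x B p k \<alpha>))"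
proof -
  have "X \<noteq> []" if "((X, y), c) \<in> set_pmf (epochs n fs \<psi> \<sigma> B p \<alpha> k x)" for X y c
    using epochs_support[OF assms(1) that] assms(2) p(1) by auto
  then show ?thesis
    unfolding natasha_full_def set_bind_pmf
    by (intro finite_UN_I finite_epochs assms) (auto simp: set_pmf_uniform_entry)
qed

lemma natasha_full_support:
  assumes "x \<in> dom" "1 \<le> k" "((y, z), c) \<in> set_pmf (natasha_full n fs \<psi> \<sigma> x B p k \<alpha>)"
  shows "y \<in> dom \<and> c \<le> 3 * B * k"
proof -
  obtain X where X: "((X, z), c) \<in> set_pmf (epochs n fs \<psi> \<sigma> B p \<alpha> k x)"
    and y: "y \<in> set_pmf (uniform_entry X)"
    using assms(3) unfolding natasha_full_def by auto
  note * = epochs_support[OF assms(1) X]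
  then have "X \<noteq> []" using assms(2) p(1) by auto
  \<comment> \<open>\<open>m\<close> is rounded down, so the inner steps, at two gradients each,
    cost at most \<open>2 * B\<close> on top of the mini batch.\<close>
  moreover have "m * p \<le> B" by simp
  then have "k * (B + 2 * m * p) \<le> k * (3 * B)" by (intro mult_le_mono2) linarith
  ultimately show ?thesis using * y by (auto simp: set_pmf_uniform_entry algebra_simps)
qed

text \<open>The random entry of \<open>X\<close> averages the residuals whose sum
  \<open>epochs_expectation\<close> controls; \<open>\<Delta>\<close> bounds the final value of
  \<open>F\<close> from below.\<close>

lemma natasha_full_expectation:
  assumes V: "\<And>x. x \<in> dom \<Longrightarrow> gradient_variance n fs x \<le> V"
    and \<Delta>: "\<And>z. z \<in> dom \<Longrightarrow> F x - \<Delta> \<le> F z" and x: "x \<in> dom" and k: "1 \<le> k"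
  shows "measure_pmf.expectation (natasha_full n fs \<psi> \<sigma> x B p k \<alpha>) (\<lambda>((y, z), c). residual y)
    \<le> 4 / \<sigma> * (\<Delta> / real (k * p) + V / (2 * \<sigma> * real B))"
proof -
  let ?P = "epochs n fs \<psi> \<sigma> B p \<alpha> k x"
  let ?h = "\<lambda>((X :: 'a list, y), _ :: nat). F y + \<sigma> / 4 * (\<Sum>x\<leftarrow>X. residual x)"
  let ?s = "4 / \<sigma> / real (k * p)"
  have kp: "real (k * p) > 0" using k p(1) by simp
  then have s: "0 \<le> ?s" using \<sigma>_pos by simp
  have "measure_pmf.expectation (natasha_full n fs \<psi> \<sigma> x B p k \<alpha>) (\<lambda>((y, z), c). residual y)
      \<le> measure_pmf.expectation ?P (\<lambda>u. ?s * (\<Delta> - F x) + ?s * ?h u)"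
    unfolding natasha_full_def
  proof (rule expectation_bind_le)
    fix u assume "u \<in> set_pmf ?P"
    moreover obtain X y c where u: "u = ((X, y), c)" by (metis surj_pair)
    ultimately have *: "length X = k * p" "y \<in> dom" using epochs_support[OF x] by blast+
    then have X: "X \<noteq> []" using k p(1) by auto
    let ?G = "\<lambda>((X :: 'a list, z :: 'a), c :: nat).
      bind_pmf (uniform_entry X) (\<lambda>y. return_pmf ((y, z), c))"
    show "finite (set_pmf (?G u))" by (simp add: u set_pmf_uniform_entry X)
    have "measure_pmf.expectation (?G u) (\<lambda>((y, z), c). residual y)
        = measure_pmf.expectation (uniform_entry X) residual"
      by (simp add: u expectation_bind_finite set_pmf_uniform_entry X)
    also have "\<dots> = (\<Sum>x\<leftarrow>X. residual x) / real (k * p)"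
      by (simp only: expectation_uniform_entry[OF X] *)
    also have "\<dots> = ?s * (\<sigma> / 4 * (\<Sum>x\<leftarrow>X. residual x))" using \<sigma>_pos by simp
    also have "\<dots> \<le> ?s * (\<Delta> - F x + ?h u)"
      using \<Delta>[OF *(2)] s by (intro mult_left_mono) (simp_all add: u)
    finally show "measure_pmf.expectation (?G u) (\<lambda>((y, z), c). residual y)
        \<le> ?s * (\<Delta> - F x) + ?s * ?h u" by (simp only: distrib_left)
  qed (rule finite_epochs[OF x])
  also have "\<dots> = ?s * (\<Delta> - F x) + ?s * measure_pmf.expectation ?P ?h"
    by (subst expectation_const_add[OF finite_epochs[OF x]]) simp
  also have "\<dots> \<le> ?s * (\<Delta> - F x) + ?s * (F x + real (k * p) * (V / (2 * \<sigma> * real B)))"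
    using s by (intro add_left_mono mult_left_mono epochs_expectation V x)
  also have "\<dots> = ?s * (\<Delta> + real (k * p) * (V / (2 * \<sigma> * real B)))"
    by (simp only: distrib_left[symmetric]) simp
  also have "\<dots> = 4 / \<sigma> * (\<Delta> / real (k * p) + V / (2 * \<sigma> * real B))"
    using k p(1) \<sigma>_pos by (simp add: divide_simps)
  finally show ?thesis .
qed

end

section \<open>The subroutine\<close>

text \<open>The second stage may have infinite support, and the expectation of a nonintegrable
  function would be 0 by default. Nonnegativity allows a passage through the nonnegative integral,
  which yields integrability along with the bound.\<close>

lemma expectation_bind_nonneg:
  fixes h :: "'b \<Rightarrow> real"
  assumes fin: "finite (set_pmf p)" and h: "\<And>x. 0 \<le> h x"
    and int: "\<And>x. x \<in> set_pmf p \<Longrightarrow> integrable (measure_pmf (g x)) h"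
    and le: "\<And>x. x \<in> set_pmf p \<Longrightarrow> measure_pmf.expectation (g x) h \<le> k x"
  shows "integrable (measure_pmf (bind_pmf p g)) h"
    and "measure_pmf.expectation (bind_pmf p g) h \<le> measure_pmf.expectation p k"
proof -
  let ?e = "\<lambda>x. measure_pmf.expectation (g x) h"
  have "(\<integral>\<^sup>+x. ennreal (h x) \<partial>bind_pmf p g) = (\<integral>\<^sup>+x. \<integral>\<^sup>+y. ennreal (h y) \<partial>g x \<partial>p)" by simp
  also have "\<dots> = (\<integral>\<^sup>+x. ennreal (?e x) \<partial>p)"
    using int h by (intro nn_integral_cong_AE AE_pmfI) (simp add: nn_integral_eq_integral)
  also have "\<dots> = ennreal (measure_pmf.expectation p ?e)"
    using h by (intro nn_integral_eq_integral integrable_measure_pmf_finite fin) simp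
  finally have nn: "(\<integral>\<^sup>+x. ennreal (h x) \<partial>bind_pmf p g) = ennreal (measure_pmf.expectation p ?e)" .
  then show int': "integrable (measure_pmf (bind_pmf p g)) h"
    using h by (intro integrableI_nn_integral_finite) auto
  have "ennreal (measure_pmf.expectation (bind_pmf p g) h) = ennreal (measure_pmf.expectation p ?e)"
    using nn nn_integral_eq_integral[OF int'] h by simp
  then have "measure_pmf.expectation (bind_pmf p g) h = measure_pmf.expectation p ?e"
    using h by simp
  also have "\<dots> \<le> measure_pmf.expectation p k"
    using fin le by (rule expectation_mono_finite)
  finally show "measure_pmf.expectation (bind_pmf p g) h \<le> measure_pmf.expectation p k" .
qed

section \<open>The regularized problem as input of the subroutine\<close>

context composite_problem
begin

abbreviation "reg_components z \<equiv> \<lambda>i x. fs i x + \<sigma> * (norm (x - z))\<^sup>2"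

lemma average_reg_components: "average n (reg_components z) = reg z"
  using n by (simp add: average_def reg_def sum.distrib add_divide_distrib fun_eq_iff)

lemma GDERIV_reg: "GDERIV (reg z) x :> reg_grad z x"
  unfolding reg_def[abs_def] reg_grad_def
  by (intro GDERIV_add GDERIV_grad GDERIV_norm_power2 f_differentiable)

lemma grad_reg: "grad (reg z) x = reg_grad z x"
  by (rule grad_eqI[OF GDERIV_reg])

lemma smooth_reg: "smooth (3 * L) (reg z)"
  unfolding smooth_def grad_reg
  using GDERIV_differentiable[OF GDERIV_reg] reg_grad_lipschitz by blast

lemma reg_convex_combination:
  "0 \<le> t \<Longrightarrow> t \<le> 1 \<Longrightarrow> reg z ((1 - t) *\<^sub>R x + t *\<^sub>R y)
    \<le> (1 - t) * reg z x + t * reg z y - \<sigma> / 2 * t * (1 - t) * (norm (x - y))\<^sup>2"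
  by (rule lower_bound_imp_convex_combination[where A = "reg_grad z", OF reg_lower])

lemma convex_on_reg: "convex_on UNIV (reg z)"
proof (rule convex_onI)
  fix t :: real and x y :: 'a
  assume t: "0 < t" "t < 1"
  then have "0 \<le> \<sigma> / 2 * t * (1 - t) * (norm (x - y))\<^sup>2" using \<sigma>_pos by simp
  then show "reg z ((1 - t) *\<^sub>R x + t *\<^sub>R y) \<le> (1 - t) * reg z x + t * reg z y"
    using reg_convex_combination[of t z x y] t by linarith
qed simp

lemma composite_reg: "x \<in> dom \<Longrightarrow> composite n (reg_components z) \<psi> x = ereal (objective z x)"
  by (simp add: composite_def average_reg_components objective_def eq_val)

lemma composite_reg_infinity: "x \<notin> dom \<Longrightarrow> composite n (reg_components z) \<psi> x = \<infinity>"
  by (simp add: composite_def eq_infinity)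

lemma strongly_convex_composite_reg: "strongly_convex \<sigma> (composite n (reg_components z) \<psi>)"
  unfolding strongly_convex_def
proof (intro allI ballI)
  fix x y :: 'a and t :: real
  assume "t \<in> {0<..<1}"
  then have t: "0 < t" "t < 1" by auto
  let ?H = "composite n (reg_components z) \<psi>"
  let ?q = "\<sigma> / 2 * t * (1 - t) * (norm (x - y))\<^sup>2"
  show "?H ((1 - t) *\<^sub>R x + t *\<^sub>R y) \<le> ereal (1 - t) * ?H x + ereal t * ?H y - ereal ?q"
  proof (cases "x \<in> dom \<and> y \<in> dom")
    case True
    note * = convex_combination[OF True[THEN conjunct1] True[THEN conjunct2] t]
    have "objective z ((1 - t) *\<^sub>R x + t *\<^sub>R y) \<le> (1 - t) * objective z x + t * objective z y - ?q"
      using *(2) reg_convex_combination[of t z x y] t unfolding objective_def distrib_left by linarith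
    then show ?thesis using True *(1) by (simp add: composite_reg)
  next
    case False
    then have infinite: "ereal (1 - t) * ?H x + ereal t * ?H y = \<infinity>"
      using t by (cases "x \<in> dom"; cases "y \<in> dom") (simp_all add: composite_reg composite_reg_infinity)
    show ?thesis unfolding infinite by simp
  qed
qed

lemma center_is_arg_min: "is_arg_min (composite n (reg_components z) \<psi>) (\<lambda>_. True) (center z)"
proof -
  have "composite n (reg_components z) \<psi> (center z) \<le> composite n (reg_components z) \<psi> x" for x
  proof (cases "x \<in> dom")
    case True
    have "0 \<le> \<sigma> / 2 * (norm (x - center z))\<^sup>2" using \<sigma>_pos by simp
    then have "objective z (center z) \<le> objective z x" using objective_center[OF True, of z] by linarith
    then show ?thesis using True center_dom by (simp add: composite_reg)
  qed (simp add: composite_reg_infinity)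
  then show ?thesis unfolding is_arg_min_def by (auto simp: not_less)
qed

text \<open>The regularizer adds the same vector to the gradient of each component and of the
  average.\<close>

lemma gradient_variance_reg: "gradient_variance n (reg_components z) x = gradient_variance n fs x"
proof -
  have "grad (average n (reg_components z)) x - grad (reg_components z i) x = grad f x - grad (fs i) x"
    if "i \<in> {1..n}" for i
    using grad_add_norm_power2[OF fs_differentiable[OF that, of x], of \<sigma> z]
    by (simp add: average_reg_components grad_reg reg_grad_def)
  then show ?thesis
    unfolding gradient_variance_def using n
    by (intro integral_cong_AE) (auto intro!: AE_pmfI simp: set_pmf_index)
qed

text \<open>At the proximal point \<open>y\<close> the vector
  \<open>g - (reg_grad z x - reg_grad z y)\<close> is a subgradient of the composite function, and 0
  is one at the center. Strong monotonicity bounds the distance of the two points, and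
  \<open>x - y\<close> is a multiple of \<open>g\<close>.\<close>

lemma center_error_bound:
  fixes x z :: 'a and \<eta> :: real
  defines "g \<equiv> gradient_mapping \<psi> (reg z) \<eta> x"
  assumes \<eta>: "0 < \<eta>" "3 * L * \<eta> \<le> 1"
  shows "\<sigma> * norm (x - center z) \<le> 4 / 3 * norm g"
proof -
  define y where "y = prox_step \<psi> \<eta> (reg_grad z x) x"
  let ?c = "center z"
  have g: "g = (1 / \<eta>) *\<^sub>R (x - y)" unfolding g_def gradient_mapping_def grad_reg y_def ..
  then have xy: "x - y = \<eta> *\<^sub>R g" using \<eta>(1) by simp
  have \<sigma>\<eta>: "0 \<le> \<sigma> * \<eta>" "\<sigma> * \<eta> \<le> L * \<eta>" using \<sigma>_pos \<sigma>_le \<eta> by (auto simp: mult_right_mono)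
  have "\<sigma> * norm (y - ?c) \<le> (1 - 2 * \<sigma> * \<eta> + L * \<eta>) * norm g"
  proof (cases "y = ?c")
    case True
    have "0 \<le> 1 - 2 * \<sigma> * \<eta> + L * \<eta>" using \<eta>(2) \<sigma>\<eta> by linarith
    then show ?thesis using True by simp
  next
    case False
    have "0 \<le> (g - reg_grad z x - - reg_grad z ?c) \<bullet> (y - ?c)"
      unfolding g y_def by (intro subgradient_mono center_subgradient prox_step_subgradient \<eta>)
    moreover have "\<sigma> * (norm (y - ?c))\<^sup>2 \<le> (reg_grad z y - reg_grad z ?c) \<bullet> (y - ?c)"
      by (rule reg_grad_mono)
    ultimately have "\<sigma> * (norm (y - ?c))\<^sup>2 \<le> (g - (reg_grad z x - reg_grad z y)) \<bullet> (y - ?c)"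
      by (simp add: inner_diff_left inner_add_left)
    also have "\<dots> \<le> norm (g - (reg_grad z x - reg_grad z y)) * norm (y - ?c)"
      by (rule norm_cauchy_schwarz)
    finally have "\<sigma> * norm (y - ?c) \<le> norm (g - (reg_grad z x - reg_grad z y))"
      using False by (simp add: power2_eq_square)
    \<comment> \<open>The regularizer's share of the gradient difference is exactly a multiple of
      \<open>g\<close> and shrinks it. Only L\<eta> \<le> 1/3 is lost on \<open>f\<close>, hence
      4/3.\<close>
    also have "g - (reg_grad z x - reg_grad z y) = (1 - 2 * \<sigma> * \<eta>) *\<^sub>R g - (grad f x - grad f y)"
    proof -
      have "reg_grad z x - reg_grad z y = (grad f x - grad f y) + (2 * \<sigma>) *\<^sub>R (x - y)"
        by (simp add: reg_grad_def algebra_simps)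
      then show ?thesis by (simp add: xy algebra_simps)
    qed
    also have "norm \<dots> \<le> norm ((1 - 2 * \<sigma> * \<eta>) *\<^sub>R g) + norm (grad f x - grad f y)"
      by (rule norm_triangle_ineq4)
    also have "\<dots> \<le> (1 - 2 * \<sigma> * \<eta>) * norm g + L * (\<eta> * norm g)"
    proof (rule add_mono)
      have "0 \<le> 1 - 2 * \<sigma> * \<eta>" using \<eta>(2) \<sigma>\<eta> by linarith
      then show "norm ((1 - 2 * \<sigma> * \<eta>) *\<^sub>R g) \<le> (1 - 2 * \<sigma> * \<eta>) * norm g" by simp
      show "norm (grad f x - grad f y) \<le> L * (\<eta> * norm g)"
        using grad_f_lipschitz[of x y] \<eta>(1) by (simp add: xy)
    qed
    finally show ?thesis by (simp add: algebra_simps)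
  qed
  moreover have "norm (x - y) = \<eta> * norm g" using \<eta>(1) by (simp add: xy)
  then have "norm (x - ?c) \<le> \<eta> * norm g + norm (y - ?c)"
    using norm_triangle_ineq[of "x - y" "y - ?c"] by simp
  then have "\<sigma> * norm (x - ?c) \<le> \<sigma> * (\<eta> * norm g + norm (y - ?c))"
    using \<sigma>_pos by (intro mult_left_mono) auto
  ultimately have "\<sigma> * norm (x - ?c) \<le> (1 - \<sigma> * \<eta> + L * \<eta>) * norm g"
    by (simp add: algebra_simps)
  also have "\<dots> \<le> 4 / 3 * norm g"
    using \<eta>(2) \<sigma>\<eta> by (intro mult_right_mono) auto
  finally show ?thesis .
qed

text \<open>By nonexpansiveness the two mappings differ by at most the gradient of the regularizer
  at \<open>x\<close>. Its norm is split at the center: the error bound handles \<open>x\<close>,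
  with 11/3 = 1 + 2 * 4/3, and the first phase of the algorithm handles \<open>z\<close>.\<close>

lemma norm_gradient_mapping_le:
  fixes x z :: 'a
  assumes \<eta>: "0 < \<eta>" "3 * L * \<eta> \<le> 1" "\<eta> \<le> \<eta>'"
  shows "norm (gradient_mapping \<psi> f \<eta>' x)
    \<le> 11 / 3 * norm (gradient_mapping \<psi> (reg z) \<eta> x) + 2 * (\<sigma> * norm (z - center z))"
proof -
  let ?g = "gradient_mapping \<psi> (reg z) \<eta> x" and ?h = "gradient_mapping \<psi> f \<eta> x"
  let ?p = "prox_step \<psi> \<eta> (reg_grad z x) x" and ?q = "prox_step \<psi> \<eta> (grad f x) x"
  have "?h - ?g = (1 / \<eta>) *\<^sub>R (?p - ?q)"
    by (simp add: gradient_mapping_def grad_reg scaleR_diff_right)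
  also have "norm \<dots> \<le> (1 / \<eta>) * norm ((x - \<eta> *\<^sub>R reg_grad z x) - (x - \<eta> *\<^sub>R grad f x))"
    using prox_step_nonexpansive[OF \<eta>(1), of "reg_grad z x" x "grad f x" x] \<eta>(1)
    by (simp add: divide_right_mono)
  also have "(x - \<eta> *\<^sub>R reg_grad z x) - (x - \<eta> *\<^sub>R grad f x) = - (\<eta> *\<^sub>R ((2 * \<sigma>) *\<^sub>R (x - z)))"
    by (simp add: reg_grad_def algebra_simps)
  also have "(1 / \<eta>) * norm \<dots> = 2 * (\<sigma> * norm (x - z))"
    using \<eta>(1) \<sigma>_pos by simp
  also have "\<dots> \<le> 2 * (\<sigma> * (norm (x - center z) + norm (z - center z)))"
    using norm_triangle_ineq4[of "x - center z" "z - center z"] \<sigma>_pos by simp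
  also have "\<dots> \<le> 2 * (4 / 3 * norm ?g) + 2 * (\<sigma> * norm (z - center z))"
    using center_error_bound[OF \<eta>(1,2), of x z] by (simp add: distrib_left)
  finally have "norm (?h - ?g) \<le> 8 / 3 * norm ?g + 2 * (\<sigma> * norm (z - center z))" by simp
  moreover have "norm ?h \<le> norm (?h - ?g) + norm ?g"
    using norm_triangle_ineq[of "?h - ?g" ?g] by simp
  moreover have "norm (gradient_mapping \<psi> f \<eta>' x) \<le> norm ?h"
    by (rule norm_gradient_mapping_antimono[OF \<eta>(1,3)])
  ultimately show ?thesis by simp
qed

lemma subroutine_guarantee:
  fixes z :: 'a
  assumes sgd: "sgd3_sc C c1 c2 sgd" and "0 < c2"
    and V: "variance_at_most V n fs \<psi>" and z: "z \<in> dom"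
    and T: "real T \<ge> 3 * L / \<sigma> * ln (3 * L / \<sigma>)"
  defines "P \<equiv> sgd n (reg_components z) \<psi> z \<sigma> (3 * L) T"
    and "\<eta> \<equiv> C / (3 * L)"
  shows "\<And>x k. (x, k) \<in> set_pmf P \<Longrightarrow> k = T"
    and "integrable (measure_pmf P) (\<lambda>(x, k). norm (gradient_mapping \<psi> (reg z) \<eta> x))"
    and "measure_pmf.expectation P (\<lambda>(x, k). norm (gradient_mapping \<psi> (reg z) \<eta> x))
      \<le> c1 * (sqrt V * ln (3 * L / \<sigma>) powr (3/2) / sqrt (real T)) + \<sigma> * norm (z - center z)"
proof -
  let ?g = "reg_components z"
  have "\<forall>i\<in>{1..n}. \<forall>x. ?g i differentiable (at x)"
    using GDERIV_differentiable GDERIV_add[OF GDERIV_grad GDERIV_norm_power2] fs_differentiable by blast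
  moreover have "variance_at_most V n ?g \<psi>"
    using V unfolding variance_at_most_def gradient_variance_reg .
  moreover have "\<psi> z < \<infinity>" using z by (simp add: dom_def)
  moreover have "3 * \<sigma> \<le> 3 * L" using \<sigma>_le by simp
  ultimately have *: "(\<forall>(x, k) \<in> set_pmf P. k = T) \<and>
      integrable (measure_pmf P) (\<lambda>(x, k). norm (gradient_mapping \<psi> (reg z) \<eta> x)) \<and>
      measure_pmf.expectation P (\<lambda>(x, k). norm (gradient_mapping \<psi> (reg z) \<eta> x))
      \<le> c1 * (sqrt V * ln (3 * L / \<sigma>) powr (3/2) / sqrt (real T))
        + (1 - \<sigma> / (3 * L)) powr (c2 * (real T / ln (3 * L / \<sigma>))) * \<sigma> * norm (z - center z)"
    using sgd[unfolded sgd3_sc_def, rule_format, of n \<psi> ?g "3 * L" \<sigma> V z "center z" T]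
      n proper attained convex_on_reg[of z] smooth_reg[of z] strongly_convex_composite_reg[of z]
      \<sigma>_pos center_is_arg_min[of z] T
    unfolding average_reg_components P_def \<eta>_def by blast
  then show "\<And>x k. (x, k) \<in> set_pmf P \<Longrightarrow> k = T"
    and "integrable (measure_pmf P) (\<lambda>(x, k). norm (gradient_mapping \<psi> (reg z) \<eta> x))"
    by auto
  have "1 < 3 * L / \<sigma>" using \<sigma>_pos \<sigma>_le by (simp add: field_simps)
  then have "0 < ln (3 * L / \<sigma>)" by simp
  then have "(1 - \<sigma> / (3 * L)) powr (c2 * (real T / ln (3 * L / \<sigma>))) \<le> 1"
    using \<open>0 < c2\<close> \<sigma>_pos \<sigma>_le L_pos by (intro powr_le1) (auto simp: field_simps)
  then have "(1 - \<sigma> / (3 * L)) powr (c2 * (real T / ln (3 * L / \<sigma>))) * (\<sigma> * norm (z - center z))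
      \<le> 1 * (\<sigma> * norm (z - center z))"
    using \<sigma>_pos by (intro mult_right_mono) auto
  then show "measure_pmf.expectation P (\<lambda>(x, k). norm (gradient_mapping \<psi> (reg z) \<eta> x))
      \<le> c1 * (sqrt V * ln (3 * L / \<sigma>) powr (3/2) / sqrt (real T)) + \<sigma> * norm (z - center z)"
    using * by (simp add: mult.assoc)
qed

end

section \<open>Parameters\<close>

lemma powr_third_cube: "0 < x \<Longrightarrow> (x powr (1/3)) ^ 3 = (x::real)"
  by (simp add: powr_power)

text \<open>The cubed logarithm in the length of the subroutine is thereby paid for by one more
  factor sqrt V / \<epsilon>, which stays within the order of \<epsilon>^-3.\<close>

lemma ln_cube_le:
  assumes "1 \<le> (x::real)"
  shows "ln x ^ 3 \<le> 27 * x"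
proof -
  have "ln x = 3 * ln (x powr (1/3))" using assms by (simp add: ln_powr)
  also have "\<dots> \<le> 3 * (x powr (1/3))"
    using ln_le_minus_one[of "x powr (1/3)"] assms by simp
  finally have "ln x ^ 3 \<le> (3 * (x powr (1/3))) ^ 3"
    using assms by (intro power_mono) auto
  also have "\<dots> = 27 * x" using assms powr_third_cube[of x] by (simp add: power_mult_distrib)
  finally show ?thesis .
qed

locale natasha_constants =
  fixes L \<sigma> V \<epsilon> :: real
  assumes \<sigma>_pos: "0 < \<sigma>" and \<sigma>_le: "\<sigma> \<le> L" and V_pos: "0 < V" and \<epsilon>_pos: "0 < \<epsilon>"
    and \<sigma>_large: "\<epsilon> * L / sqrt V \<le> \<sigma>"
begin

abbreviation "batch \<equiv> epoch_length V \<epsilon>"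
abbreviation "pieces \<equiv> sub_epoch_count L \<sigma> batch"
abbreviation "rate \<equiv> learning_rate L \<sigma> pieces"
abbreviation "ratio \<equiv> sqrt V / \<epsilon>"

lemma L_pos: "0 < L" using \<sigma>_pos \<sigma>_le by simp

lemma condition_le: "L / \<sigma> \<le> ratio"
  using \<sigma>_large \<sigma>_pos V_pos \<epsilon>_pos by (simp add: field_simps)

lemma ratio_ge_1: "1 \<le> ratio"
proof -
  have "1 \<le> L / \<sigma>" using \<sigma>_pos \<sigma>_le by simp
  then show ?thesis using condition_le by linarith
qed

lemma ratio_power2: "ratio\<^sup>2 = V / \<epsilon>\<^sup>2"
  using V_pos by (simp add: power_divide)

lemma ratio2_ge_1: "1 \<le> V / \<epsilon>\<^sup>2"
  using ratio_ge_1 unfolding ratio_power2[symmetric] by simp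

lemma ratio2_condition: "L\<^sup>2 \<le> V / \<epsilon>\<^sup>2 * \<sigma>\<^sup>2"
proof -
  have "(L / \<sigma>)\<^sup>2 \<le> ratio\<^sup>2"
    using condition_le L_pos \<sigma>_pos by (intro power_mono) auto
  then show ?thesis unfolding ratio_power2 using \<sigma>_pos by (simp add: power_divide pos_divide_le_eq)
qed

lemma batch_bounds: "10000 * (V / \<epsilon>\<^sup>2) \<le> real batch" "real batch \<le> 10001 * (V / \<epsilon>\<^sup>2)"
proof -
  have "0 \<le> 10000 * (V / \<epsilon>\<^sup>2)" using V_pos by simp
  then have eq: "real batch = of_int \<lceil>10000 * (V / \<epsilon>\<^sup>2)\<rceil>"
    unfolding epoch_length_def by simp
  show "10000 * (V / \<epsilon>\<^sup>2) \<le> real batch" unfolding eq by (rule le_of_int_ceiling)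
  have "real batch \<le> 10000 * (V / \<epsilon>\<^sup>2) + 1" unfolding eq by (rule of_int_ceiling_le_add_one)
  then show "real batch \<le> 10001 * (V / \<epsilon>\<^sup>2)"
    using ratio2_ge_1 by linarith
qed

lemma batch_pos: "1 \<le> batch"
proof -
  have "0 < real batch" using batch_bounds(1) ratio2_ge_1 by linarith
  then show ?thesis by simp
qed

definition raw_pieces :: real where "raw_pieces = (\<sigma>\<^sup>2 / (48 * L\<^sup>2) * real batch) powr (1/3)"

text \<open>This keeps the rounded number of sub-epochs positive; the factor 10^4 of the batch size
  outweighs the 48.\<close>

lemma base_ge_1: "1 \<le> \<sigma>\<^sup>2 / (48 * L\<^sup>2) * real batch"
proof -
  have "48 * L\<^sup>2 \<le> 10000 * (V / \<epsilon>\<^sup>2 * \<sigma>\<^sup>2)" using ratio2_condition zero_le_power2[of L] by linarith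
  also have "\<dots> \<le> \<sigma>\<^sup>2 * real batch"
    using mult_left_mono[OF batch_bounds(1), of "\<sigma>\<^sup>2"] by (simp add: mult_ac)
  finally show ?thesis using L_pos by (simp add: field_simps)
qed

lemma raw_pieces_cube: "raw_pieces ^ 3 = \<sigma>\<^sup>2 / (48 * L\<^sup>2) * real batch"
  unfolding raw_pieces_def using base_ge_1 by (intro powr_third_cube) simp

lemma raw_pieces_ge_1: "1 \<le> raw_pieces"
  unfolding raw_pieces_def using base_ge_1 by (rule ge_one_powr_ge_zero) simp

lemma pieces_bounds: "real pieces \<le> raw_pieces" "raw_pieces / 2 \<le> real pieces" "1 \<le> pieces"
proof -
  have c: "real pieces = of_int \<lfloor>raw_pieces\<rfloor>"
    using raw_pieces_ge_1 unfolding sub_epoch_count_def raw_pieces_def[symmetric] by simp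
  have "1 \<le> \<lfloor>raw_pieces\<rfloor>" using raw_pieces_ge_1 by (simp add: le_floor_iff)
  then show "1 \<le> pieces" using c by linarith
  show "real pieces \<le> raw_pieces" unfolding c by simp
  show "raw_pieces / 2 \<le> real pieces"
    using \<open>1 \<le> \<lfloor>raw_pieces\<rfloor>\<close> unfolding c by linarith
qed

lemma pieces_cube: "48 * L\<^sup>2 * real pieces ^ 3 \<le> \<sigma>\<^sup>2 * real batch"
proof -
  have "real pieces ^ 3 \<le> raw_pieces ^ 3" using pieces_bounds(1) by (intro power_mono) auto
  then show ?thesis unfolding raw_pieces_cube using L_pos by (simp add: field_simps)
qed

lemma four_pieces_le: "4 * pieces \<le> batch"
proof -
  have "48 * L\<^sup>2 * real pieces ^ 3 \<le> L\<^sup>2 * real batch"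
  proof -
    have "\<sigma>\<^sup>2 * real batch \<le> L\<^sup>2 * real batch"
      using \<sigma>_pos \<sigma>_le by (intro mult_right_mono power_mono) auto
    then show ?thesis using pieces_cube by linarith
  qed
  then have "L\<^sup>2 * (48 * real pieces ^ 3) \<le> L\<^sup>2 * real batch" by (simp add: mult_ac)
  then have "48 * real pieces ^ 3 \<le> real batch" using L_pos by simp
  moreover have "real pieces \<le> real pieces ^ 3"
    using pieces_bounds(3) by (intro self_le_power) auto
  ultimately have "4 * real pieces \<le> real batch" by linarith
  then show ?thesis by linarith
qed

lemma four_le_div: "4 \<le> batch div pieces"
  using four_pieces_le pieces_bounds(3) by (simp add: less_eq_div_iff_mult_less_eq)

lemma rate_pos: "0 < rate"
  using \<sigma>_pos L_pos pieces_bounds(3) by (simp add: learning_rate_def)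

lemma rate_le: "6 * rate * L \<le> 1"
proof -
  have "1 \<le> (real pieces)\<^sup>2" using pieces_bounds(3) by simp
  then have "\<sigma> * 1 \<le> L * (real pieces)\<^sup>2" using \<sigma>_le \<sigma>_pos by (intro mult_mono) auto
  then show ?thesis
    using L_pos pieces_bounds(3) by (simp add: learning_rate_def field_simps power2_eq_square)
qed

lemma rate_pieces_le: "4 * (real pieces)\<^sup>2 * (rate * L\<^sup>2) \<le> \<sigma>"
  using \<sigma>_pos L_pos pieces_bounds(3) by (simp add: learning_rate_def)

text \<open>Rounding costs a factor 2, as \<open>batch\<close> is at most twice the product of
  quotient and divisor. The 48 in the number of pieces is made for this: 48 / 2 = 24 = 4 * 6, with
  1/6 from the learning rate.\<close>

lemma rate_steps: "4 / \<sigma> \<le> rate * real (batch div pieces)"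
proof -
  let ?p = "real pieces" and ?m = "real (batch div pieces)"
  have p: "?p > 0" using pieces_bounds(3) by simp
  have "batch \<le> 2 * ((batch div pieces) * pieces)"
    using four_pieces_le pieces_bounds(3) div_mult_mod_eq[of batch pieces] mod_less_divisor[of pieces batch]
    by linarith
  then have "real batch \<le> 2 * (?m * ?p)" by (metis of_nat_le_iff of_nat_mult of_nat_numeral)
  then have "\<sigma>\<^sup>2 * real batch \<le> \<sigma>\<^sup>2 * (2 * (?m * ?p))" by (intro mult_left_mono) auto
  then have "?p * (48 * L\<^sup>2 * ?p\<^sup>2) \<le> ?p * (2 * \<sigma>\<^sup>2 * ?m)"
    using pieces_cube by (simp add: power2_eq_square power3_eq_cube mult_ac)
  then have "24 * (L\<^sup>2 * ?p\<^sup>2) \<le> \<sigma>\<^sup>2 * ?m" using p by simp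
  then show ?thesis
    using \<sigma>_pos L_pos p by (simp add: learning_rate_def field_simps power2_eq_square)
qed

text \<open>A single cube root carries the fractional powers of \<open>V\<close> and \<epsilon>, so
  that inequalities can be checked on cubes.\<close>

definition ratio_root :: real where "ratio_root = (V / \<epsilon>\<^sup>2) powr (1/3)"

lemma ratio_root_cube: "ratio_root ^ 3 = V / \<epsilon>\<^sup>2"
  unfolding ratio_root_def using V_pos \<epsilon>_pos by (intro powr_third_cube) simp

lemma ratio_root_power2: "V powr (2/3) / \<epsilon> powr (10/3) = ratio_root\<^sup>2 / \<epsilon>\<^sup>2"
proof -
  have "ratio_root\<^sup>2 = (V / \<epsilon>\<^sup>2) powr (2/3)"
    unfolding ratio_root_def using V_pos \<epsilon>_pos by (simp add: powr_power)
  also have "\<dots> = V powr (2/3) / (\<epsilon> powr 2) powr (2/3)"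
    using V_pos \<epsilon>_pos by (simp add: powr_divide powr_numeral)
  also have "\<dots> = V powr (2/3) / \<epsilon> powr (4/3)" by (simp add: powr_powr)
  finally have "ratio_root\<^sup>2 / \<epsilon>\<^sup>2 = V powr (2/3) / (\<epsilon> powr (4/3) * \<epsilon> powr 2)"
    using \<epsilon>_pos by (simp add: powr_numeral)
  also have "\<epsilon> powr (4/3) * \<epsilon> powr 2 = \<epsilon> powr (10/3)"
    by (simp add: powr_add[symmetric])
  finally show ?thesis by simp
qed

lemma natasha_length_eq: "natasha_length L V \<Delta> \<epsilon> \<sigma> = 100000000 * ((L\<^sup>2 * \<sigma>) powr (1/3) * \<Delta> * (ratio_root\<^sup>2 / \<epsilon>\<^sup>2))"
  unfolding natasha_length_def ratio_root_power2[symmetric] by simp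

text \<open>After cubing, both sides share the factor \<open>\<sigma> ^ 3 * real batch\<close>; what
  remains compares the squared batch size with 2000^3/48 times the square of
  \<open>V / \<epsilon>\<^sup>2\<close>, and 10001^2 is below 2000^3/48.\<close>

lemma raw_pieces_lower: "\<sigma> * real batch \<le> 2000 * ratio_root\<^sup>2 * ((L\<^sup>2 * \<sigma>) powr (1/3) * raw_pieces)"
proof (rule power_le_imp_le_base)
  let ?l = "(L\<^sup>2 * \<sigma>) powr (1/3)" and ?q = "V / \<epsilon>\<^sup>2"
  have l: "?l ^ 3 = L\<^sup>2 * \<sigma>" using L_pos \<sigma>_pos by (intro powr_third_cube) simp
  have "(2000 * ratio_root\<^sup>2 * (?l * raw_pieces)) ^ 3 = 2000 ^ 3 * (ratio_root ^ 3)\<^sup>2 * (?l ^ 3 * raw_pieces ^ 3)"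
    by (simp add: power_mult_distrib power2_eq_square power3_eq_cube)
  also have "\<dots> = 2000 ^ 3 / 48 * ?q\<^sup>2 * (\<sigma> ^ 3 * real batch)"
    using L_pos unfolding ratio_root_cube l raw_pieces_cube by (simp add: power2_eq_square power3_eq_cube)
  also have "\<dots> \<ge> (real batch)\<^sup>2 * (\<sigma> ^ 3 * real batch)"
  proof (rule mult_right_mono)
    have "(real batch)\<^sup>2 \<le> (10001 * ?q)\<^sup>2" using batch_bounds(2) by (intro power_mono) auto
    also have "\<dots> = 10001\<^sup>2 * ?q\<^sup>2" by (simp only: power_mult_distrib)
    also have "\<dots> \<le> 2000 ^ 3 / 48 * ?q\<^sup>2" by (intro mult_right_mono) (simp_all)
    finally show "(real batch)\<^sup>2 \<le> 2000 ^ 3 / 48 * ?q\<^sup>2" .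
  qed (use \<sigma>_pos in simp)
  also have "(real batch)\<^sup>2 * (\<sigma> ^ 3 * real batch) = (\<sigma> * real batch) ^ 3"
    by (simp add: power2_eq_square power3_eq_cube)
  finally show "(\<sigma> * real batch) ^ Suc 2 \<le> (2000 * ratio_root\<^sup>2 * (?l * raw_pieces)) ^ Suc 2" by simp
  show "0 \<le> 2000 * ratio_root\<^sup>2 * (?l * raw_pieces)" using raw_pieces_ge_1 by simp
qed

text \<open>There are at least T0/B epochs. Half of the 10^8 in \<open>natasha_length\<close>, the
  other half being lost by rounding the pieces, is 25000 * 2000. The two terms are then at most
  4/25000 and 2/10000 of \<open>\<epsilon>\<^sup>2\<close>.\<close>

lemma residual_small:
  assumes "0 \<le> \<Delta>"
  defines "k \<equiv> epoch_count (natasha_length L V \<Delta> \<epsilon> \<sigma>) batch"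
  shows "\<sigma>\<^sup>2 * (4 / \<sigma> * (\<Delta> / real (k * pieces) + V / (2 * \<sigma> * real batch))) \<le> \<epsilon>\<^sup>2 / 100"
proof -
  let ?T = "natasha_length L V \<Delta> \<epsilon> \<sigma>" and ?l = "(L\<^sup>2 * \<sigma>) powr (1/3)"
  have B: "0 < real batch" using batch_pos by simp
  have k1: "1 \<le> k" by (simp add: k_def epoch_count_def)
  have kp: "0 < real (k * pieces)" using k1 pieces_bounds(3) by simp
  have "?T / real batch \<le> real k"
    unfolding k_def epoch_count_def using real_nat_ceiling_ge[of "?T / real batch"] by linarith
  then have "?T \<le> real k * real batch" using B by (simp add: pos_divide_le_eq)
  then have "?T * (raw_pieces / 2) \<le> real k * real batch * real pieces"
    using raw_pieces_ge_1 pieces_bounds(2) by (intro mult_mono) auto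
  then have "\<epsilon>\<^sup>2 * (?T * (raw_pieces / 2)) \<le> \<epsilon>\<^sup>2 * (real k * real batch * real pieces)"
    by (rule mult_left_mono) simp
  moreover have "\<epsilon>\<^sup>2 * (?T * (raw_pieces / 2)) = 25000 * \<Delta> * (2000 * ratio_root\<^sup>2 * (?l * raw_pieces))"
    unfolding natasha_length_eq using \<epsilon>_pos by (simp add: field_simps)
  moreover have "25000 * \<Delta> * (\<sigma> * real batch) \<le> 25000 * \<Delta> * (2000 * ratio_root\<^sup>2 * (?l * raw_pieces))"
    using raw_pieces_lower assms(1) by (intro mult_left_mono) auto
  ultimately have "25000 * \<Delta> * (\<sigma> * real batch) \<le> \<epsilon>\<^sup>2 * (real k * real batch * real pieces)"
    by linarith
  then have "real batch * (25000 * \<Delta> * \<sigma>) \<le> real batch * (\<epsilon>\<^sup>2 * real (k * pieces))"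
    by (simp add: mult_ac)
  then have "25000 * \<Delta> * \<sigma> \<le> \<epsilon>\<^sup>2 * real (k * pieces)" using B by simp
  then have "25000 * (\<Delta> * \<sigma> / real (k * pieces)) \<le> \<epsilon>\<^sup>2" using kp by (simp add: field_simps)
  moreover have "10000 * (V / real batch) \<le> \<epsilon>\<^sup>2"
    using batch_bounds(1) B \<epsilon>_pos by (simp add: field_simps)
  moreover have "\<sigma>\<^sup>2 * (4 / \<sigma> * (\<Delta> / real (k * pieces) + V / (2 * \<sigma> * real batch)))
      = 4 * (\<Delta> * \<sigma> / real (k * pieces)) + 2 * (V / real batch)"
  proof -
    have "\<sigma>\<^sup>2 * (4 / \<sigma> * (a + V / (2 * \<sigma> * real batch))) = 4 * (a * \<sigma>) + 2 * (V / real batch)" for a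
      using \<sigma>_pos B by (simp add: field_simps power2_eq_square)
    from this[of "\<Delta> / real (k * pieces)"] show ?thesis by simp
  qed
  moreover have "0 \<le> \<epsilon>\<^sup>2" by simp
  ultimately show ?thesis by linarith
qed

abbreviation "log_condition \<equiv> ln (3 * L / \<sigma>)"

lemma log_condition_ge_1: "1 \<le> log_condition"
proof -
  have "3 \<le> 3 * L / \<sigma>" using \<sigma>_pos \<sigma>_le by (simp add: field_simps)
  then show ?thesis using exp_le L_pos \<sigma>_pos by (subst ln_ge_iff) auto
qed

lemma sgd_length_ge: "(100 * c1\<^sup>2 + 3) * (V / \<epsilon>\<^sup>2 * log_condition ^ 3) \<le> real (sgd_length c1 L V \<epsilon> \<sigma>)"
  unfolding sgd_length_def by (rule real_nat_ceiling_ge)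

text \<open>The summand 3 in \<open>sgd_length\<close> serves this purpose: the condition number is
  at most the ratio, hence at most its square.\<close>

lemma sgd_length_sufficient: "3 * L / \<sigma> * log_condition \<le> real (sgd_length c1 L V \<epsilon> \<sigma>)"
proof -
  let ?l = log_condition
  have l: "1 \<le> ?l" by (rule log_condition_ge_1)
  have "ratio \<le> ratio\<^sup>2" using self_le_power[OF ratio_ge_1, of 2] by simp
  then have "L / \<sigma> \<le> V / \<epsilon>\<^sup>2" using condition_le unfolding ratio_power2 by linarith
  moreover have "?l \<le> ?l ^ 3" using self_le_power[OF l, of 3] by simp
  ultimately have "L / \<sigma> * ?l \<le> V / \<epsilon>\<^sup>2 * ?l ^ 3"
    using l L_pos V_pos by (intro mult_mono) auto
  then have "3 * (L / \<sigma> * ?l) \<le> 3 * (V / \<epsilon>\<^sup>2 * ?l ^ 3)" by simp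
  also have "\<dots> \<le> (100 * c1\<^sup>2 + 3) * (V / \<epsilon>\<^sup>2 * ?l ^ 3)"
    using l V_pos by (intro mult_right_mono) auto
  also note sgd_length_ge
  finally show ?thesis by simp
qed

lemma sgd_error_small:
  assumes "0 < c1"
  shows "c1 * (sqrt V * log_condition powr (3/2) / sqrt (real (sgd_length c1 L V \<epsilon> \<sigma>))) \<le> \<epsilon> / 10"
proof -
  let ?l = log_condition and ?T = "real (sgd_length c1 L V \<epsilon> \<sigma>)"
  have l: "1 \<le> ?l" by (rule log_condition_ge_1)
  have "?l powr (3/2) = (?l powr 3) powr (1/2)" by (simp add: powr_powr)
  also have "\<dots> = sqrt (?l ^ 3)" using l by (simp add: powr_numeral powr_half_sqrt)
  finally have lp: "?l powr (3/2) = sqrt (?l ^ 3)" .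
  have "(10 * c1 / \<epsilon>)\<^sup>2 * (V * ?l ^ 3) = 100 * c1\<^sup>2 * (V / \<epsilon>\<^sup>2 * ?l ^ 3)"
    by (simp add: power_divide power_mult_distrib)
  also have "\<dots> \<le> (100 * c1\<^sup>2 + 3) * (V / \<epsilon>\<^sup>2 * ?l ^ 3)"
    using l V_pos by (intro mult_right_mono) auto
  also have "\<dots> \<le> ?T" by (rule sgd_length_ge)
  finally have "sqrt ((10 * c1 / \<epsilon>)\<^sup>2 * (V * ?l ^ 3)) \<le> sqrt ?T" by (rule real_sqrt_le_mono)
  moreover have "sqrt ((10 * c1 / \<epsilon>)\<^sup>2 * (V * ?l ^ 3)) = 10 * c1 / \<epsilon> * (sqrt V * sqrt (?l ^ 3))"
    using assms \<epsilon>_pos by (simp add: real_sqrt_mult)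
  ultimately have le: "10 * c1 / \<epsilon> * (sqrt V * sqrt (?l ^ 3)) \<le> sqrt ?T" by simp
  have "0 < 10 * c1 / \<epsilon> * (sqrt V * sqrt (?l ^ 3))" using assms \<epsilon>_pos V_pos l by simp
  with le have "0 < sqrt ?T" by linarith
  then show ?thesis using le \<epsilon>_pos unfolding lp by (simp add: field_simps)
qed

lemma sgd_length_le: "real (sgd_length c1 L V \<epsilon> \<sigma>) \<le> (8100 * c1\<^sup>2 + 244) * (V powr (3/2) / \<epsilon> ^ 3)"
  and batch_le: "real batch \<le> 10001 * (V powr (3/2) / \<epsilon> ^ 3)"
proof -
  let ?l = log_condition
  have l: "1 \<le> ?l" by (rule log_condition_ge_1)
  have r: "ratio ^ 3 = V powr (3/2) / \<epsilon> ^ 3"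
  proof -
    have "sqrt V ^ 3 = V powr (3/2)"
      using V_pos by (simp add: powr_half_sqrt[symmetric] powr_power)
    then show ?thesis by (simp add: power_divide)
  qed
  have "real batch \<le> 10001 * ratio\<^sup>2" using batch_bounds(2) unfolding ratio_power2 .
  also have "\<dots> \<le> 10001 * ratio ^ 3" using ratio_ge_1 power_increasing[of 2 3 ratio] by simp
  finally show "real batch \<le> 10001 * (V powr (3/2) / \<epsilon> ^ 3)" unfolding r .
  have "?l \<le> ln (3 * ratio)"
    using condition_le L_pos \<sigma>_pos ratio_ge_1 by (subst ln_le_cancel_iff) auto
  then have "?l ^ 3 \<le> ln (3 * ratio) ^ 3" using l by (intro power_mono) auto
  also have "\<dots> \<le> 27 * (3 * ratio)" using ratio_ge_1 by (intro ln_cube_le) simp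
  finally have "V / \<epsilon>\<^sup>2 * ?l ^ 3 \<le> V / \<epsilon>\<^sup>2 * (81 * ratio)"
    using V_pos by (intro mult_left_mono) auto
  also have "\<dots> = 81 * ratio ^ 3"
    unfolding ratio_power2[symmetric] by (simp add: power2_eq_square power3_eq_cube)
  finally have *: "(100 * c1\<^sup>2 + 3) * (V / \<epsilon>\<^sup>2 * ?l ^ 3) \<le> (100 * c1\<^sup>2 + 3) * (81 * ratio ^ 3)"
    by (intro mult_left_mono) auto
  have "0 \<le> (100 * c1\<^sup>2 + 3) * (V / \<epsilon>\<^sup>2 * ?l ^ 3)" using l V_pos by simp
  then have "real (sgd_length c1 L V \<epsilon> \<sigma>) \<le> (100 * c1\<^sup>2 + 3) * (V / \<epsilon>\<^sup>2 * ?l ^ 3) + 1"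
    unfolding sgd_length_def by linarith
  moreover have "1 \<le> ratio ^ 3" using ratio_ge_1 by (rule one_le_power)
  ultimately have "real (sgd_length c1 L V \<epsilon> \<sigma>) \<le> (100 * c1\<^sup>2 + 3) * (81 * ratio ^ 3) + ratio ^ 3"
    using * by linarith
  \<comment> \<open>Here 8100 = 81 * 100 and 244 = 81 * 3 + 1, the 1 coming from rounding
    up.\<close>
  also have "\<dots> = (8100 * c1\<^sup>2 + 244) * ratio ^ 3" by (simp add: algebra_simps)
  finally show "real (sgd_length c1 L V \<epsilon> \<sigma>) \<le> (8100 * c1\<^sup>2 + 244) * (V powr (3/2) / \<epsilon> ^ 3)"
    unfolding r .
qed

end

section \<open>Conclusion\<close>

context composite_problem
begin

lemma subroutine_output:
  fixes z :: 'a
  assumes sgd: "sgd3_sc C c1 c2 sgd" and "0 < c2" and C: "0 < C" "C \<le> 1"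
    and V: "variance_at_most V n fs \<psi>" and z: "z \<in> dom"
    and T: "real T \<ge> 3 * L / \<sigma> * ln (3 * L / \<sigma>)"
  defines "P \<equiv> sgd n (reg_components z) \<psi> z \<sigma> (3 * L) T"
  shows "integrable (measure_pmf P) (\<lambda>(x, k). norm (gradient_mapping \<psi> f (C / L) x))"
    and "measure_pmf.expectation P (\<lambda>(x, k). norm (gradient_mapping \<psi> f (C / L) x))
      \<le> 11 / 3 * (c1 * (sqrt V * ln (3 * L / \<sigma>) powr (3/2) / sqrt (real T)))
        + 17 / 3 * (\<sigma> * norm (z - center z))"
proof -
  let ?\<eta> = "C / (3 * L)"
  let ?g = "\<lambda>(x, k :: nat). norm (gradient_mapping \<psi> (reg z) ?\<eta> x)"
  let ?h = "\<lambda>(x, k :: nat). norm (gradient_mapping \<psi> f (C / L) x)"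
  let ?r = "\<sigma> * norm (z - center z)"
  note guarantee = subroutine_guarantee[OF sgd \<open>0 < c2\<close> V z T, folded P_def]
  have \<eta>: "0 < ?\<eta>" "3 * L * ?\<eta> \<le> 1" "?\<eta> \<le> C / L"
    using C L_pos by (auto simp: field_simps)
  have le: "?h u \<le> 11 / 3 * ?g u + 2 * ?r" for u
    using norm_gradient_mapping_le[OF \<eta>, of "fst u" z] by (simp add: split_def)
  have int: "integrable (measure_pmf P) (\<lambda>u. 11 / 3 * ?g u + 2 * ?r)"
    using guarantee(2) by (intro Bochner_Integration.integrable_add integrable_mult_right) auto
  have "0 \<le> ?h u" for u by (simp add: split_def)
  then have "norm (?h u) \<le> norm (11 / 3 * ?g u + 2 * ?r)" for u
    using le[of u] by (smt (verit) real_norm_def)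
  then show inth: "integrable (measure_pmf P) ?h"
    by (intro Bochner_Integration.integrable_bound[OF int] AE_pmfI) auto
  have "measure_pmf.expectation P ?h \<le> measure_pmf.expectation P (\<lambda>u. 11 / 3 * ?g u + 2 * ?r)"
    using inth int le by (rule integral_mono)
  also have "\<dots> = 11 / 3 * measure_pmf.expectation P ?g + 2 * ?r"
    using guarantee(2) by (subst Bochner_Integration.integral_add) (simp_all add: split_def)
  also have "\<dots> \<le> 11 / 3 * (c1 * (sqrt V * ln (3 * L / \<sigma>) powr (3/2) / sqrt (real T)) + ?r) + 2 * ?r"
    using guarantee(3) by (intro add_right_mono mult_left_mono) auto
  finally show "measure_pmf.expectation P ?h
      \<le> 11 / 3 * (c1 * (sqrt V * ln (3 * L / \<sigma>) powr (3/2) / sqrt (real T))) + 17 / 3 * ?r"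
    by (simp add: distrib_left)
qed

end

text \<open>A maximum is at most the sum. The replacement value of \<sigma> yields \<epsilon>^(1/3 -
  10/3) = \<epsilon>^-3, and the original \<sigma> yields the other term of the complexity.\<close>

lemma natasha_length_sigma_used_le:
  assumes "0 < L" "0 < \<sigma>" "0 < V" "0 < \<epsilon>" "0 \<le> \<Delta>"
  shows "natasha_length L V \<Delta> \<epsilon> (sigma_used L V \<epsilon> \<sigma>)
    \<le> 10^8 * (\<Delta> * (L * sqrt V * (1 / \<epsilon> ^ 3) + (L * V) powr (2/3) * (\<sigma> powr (1/3) / \<epsilon> powr (10/3))))"
proof -
  let ?\<tau> = "\<epsilon> * L / sqrt V"
  let ?c = "V powr (2/3) / \<epsilon> powr (10/3)"
  have L2: "(L\<^sup>2) powr (1/3) = L powr (2/3)"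
    using assms(1) powr_powr[of L 2 "1/3"] by (simp add: powr_numeral)
  have e1: "(L\<^sup>2 * \<sigma>) powr (1/3) * ?c = (L * V) powr (2/3) * (\<sigma> powr (1/3) / \<epsilon> powr (10/3))"
    using assms by (simp add: powr_mult L2)
  have e2: "(L\<^sup>2 * ?\<tau>) powr (1/3) * ?c = L * sqrt V * (1 / \<epsilon> ^ 3)"
  proof -
    have L3: "(L ^ 3) powr (1/3) = L"
      using assms(1) powr_powr[of L 3 "1/3"] by (simp add: powr_numeral)
    have "L\<^sup>2 * ?\<tau> = L ^ 3 * (\<epsilon> / V powr (1/2))"
      using assms by (simp add: powr_half_sqrt power2_eq_square power3_eq_cube)
    then have "(L\<^sup>2 * ?\<tau>) powr (1/3) = L * (\<epsilon> powr (1/3) / V powr (1/6))"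
      using assms by (simp add: powr_mult powr_divide powr_powr L3)
    then have "(L\<^sup>2 * ?\<tau>) powr (1/3) * ?c
        = L * (V powr (2/3) / V powr (1/6)) * (\<epsilon> powr (1/3) / \<epsilon> powr (10/3))"
      by simp
    also have "V powr (2/3) / V powr (1/6) = sqrt V"
      using assms by (simp add: powr_diff[symmetric] powr_half_sqrt)
    also have "\<epsilon> powr (1/3) / \<epsilon> powr (10/3) = 1 / \<epsilon> ^ 3"
      using assms by (simp add: powr_diff[symmetric] powr_minus_divide powr_numeral)
    finally show ?thesis .
  qed
  have "(L\<^sup>2 * sigma_used L V \<epsilon> \<sigma>) powr (1/3) \<le> (L\<^sup>2 * ?\<tau>) powr (1/3) + (L\<^sup>2 * \<sigma>) powr (1/3)"
    by (cases "\<sigma> \<le> ?\<tau>") (simp_all add: sigma_used_def max_def)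
  then have "(L\<^sup>2 * sigma_used L V \<epsilon> \<sigma>) powr (1/3) * (\<Delta> * ?c)
      \<le> ((L\<^sup>2 * ?\<tau>) powr (1/3) + (L\<^sup>2 * \<sigma>) powr (1/3)) * (\<Delta> * ?c)"
    using assms by (intro mult_right_mono) auto
  also have "\<dots> = \<Delta> * ((L\<^sup>2 * ?\<tau>) powr (1/3) * ?c + (L\<^sup>2 * \<sigma>) powr (1/3) * ?c)"
    by (simp only: distrib_left distrib_right mult_ac)
  finally show ?thesis unfolding natasha_length_def e1 e2 by simp
qed

lemma epoch_count_mult_le:
  assumes "0 \<le> T" "1 \<le> B"
  shows "real (epoch_count T B) * real B \<le> T + real B"
proof -
  have "0 \<le> T / real B" using assms by simp
  then have "real (epoch_count T B) \<le> T / real B + 1"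
    unfolding epoch_count_def by linarith
  then have "real (epoch_count T B) * real B \<le> (T / real B + 1) * real B"
    by (rule mult_right_mono) simp
  also have "\<dots> = T + real B" using assms by (simp add: distrib_right)
  finally show ?thesis .
qed

lemma complexity_bound:
  assumes "0 < L" "0 < \<sigma>" "0 < V" "0 < \<epsilon>" "0 \<le> \<Delta>"
    and "sigma_used L V \<epsilon> \<sigma> \<le> L"
  defines "s \<equiv> sigma_used L V \<epsilon> \<sigma>"
  shows "3 * (real (epoch_count (natasha_length L V \<Delta> \<epsilon> s) (epoch_length V \<epsilon>)) * real (epoch_length V \<epsilon>))
      + real (sgd_length c1 L V \<epsilon> s)
    \<le> complexity_constant c1 L \<Delta> V * (1 / \<epsilon> ^ 3 + \<sigma> powr (1/3) / \<epsilon> powr (10/3))"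
proof -
  interpret C: natasha_constants L s V \<epsilon>
    using assms by unfold_locales (auto simp: sigma_used_def max_def)
  let ?T = "natasha_length L V \<Delta> \<epsilon> s" and ?B = "epoch_length V \<epsilon>"
  let ?a = "\<Delta> * (L * sqrt V)" and ?b = "\<Delta> * (L * V) powr (2/3)" and ?c = "V powr (3/2)"
  let ?u = "1 / \<epsilon> ^ 3" and ?v = "\<sigma> powr (1/3) / \<epsilon> powr (10/3)"
  define A D where "A = ?a * ?u + ?b * ?v" and "D = ?c * ?u"
  have nonneg: "0 \<le> ?a" "0 \<le> ?b" "0 \<le> ?c" "0 \<le> ?u" "0 \<le> ?v" using assms by auto
  have "0 \<le> ?T" using assms by (simp add: natasha_length_def)
  then have "3 * (real (epoch_count ?T ?B) * real ?B) \<le> 3 * ?T + 3 * real ?B"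
    using epoch_count_mult_le C.batch_pos by fastforce
  moreover have "?T \<le> 100000000 * A"
    using natasha_length_sigma_used_le[OF assms(1-5)] by (simp add: s_def A_def distrib_left mult_ac)
  moreover have "real ?B \<le> 10001 * D" using C.batch_le by (simp add: D_def)
  moreover have "real (sgd_length c1 L V \<epsilon> s) \<le> 8100 * (c1\<^sup>2 * D) + 244 * D"
    using C.sgd_length_le[of c1] by (simp add: D_def distrib_right add_divide_distrib)
  \<comment> \<open>30247 = 3 * 10001 + 244. The next step adds the nonnegative cross products in
    order to factor out the sum \<open>?u + ?v\<close>.\<close>
  ultimately have "3 * (real (epoch_count ?T ?B) * real ?B) + real (sgd_length c1 L V \<epsilon> s)
      \<le> 300000000 * A + (8100 * (c1\<^sup>2 * D) + 30247 * D)"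
    by linarith
  also have "\<dots> = 300000000 * (?a * ?u + ?b * ?v) + (8100 * c1\<^sup>2 + 30247) * (?c * ?u)"
    unfolding A_def D_def by (simp only: distrib_right mult.assoc)
  also have "\<dots> \<le> 10^9 * ((?a + ?b) * (?u + ?v)) + 10^5 * ((1 + c1\<^sup>2) * ?c) * (?u + ?v)"
  proof (rule add_mono)
    have "?a * ?u + ?b * ?v \<le> (?a + ?b) * (?u + ?v)"
      using mult_nonneg_nonneg[OF nonneg(1,5)] mult_nonneg_nonneg[OF nonneg(2,4)]
      by (simp only: distrib_left distrib_right)
    moreover have "0 \<le> (?a + ?b) * (?u + ?v)"
      by (rule mult_nonneg_nonneg[OF add_nonneg_nonneg[OF nonneg(1,2)] add_nonneg_nonneg[OF nonneg(4,5)]])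
    moreover have "300000000 * x \<le> 10^9 * y" if "x \<le> y" "0 \<le> y" for x y :: real
      using that by simp
    ultimately show "300000000 * (?a * ?u + ?b * ?v) \<le> 10^9 * ((?a + ?b) * (?u + ?v))" by blast
    have "8100 * c1\<^sup>2 + 30247 \<le> 10^5 * (1 + c1\<^sup>2)" by simp
    moreover have "?c * ?u \<le> ?c * (?u + ?v)" using nonneg by (intro mult_left_mono) auto
    ultimately have "(8100 * c1\<^sup>2 + 30247) * (?c * ?u) \<le> 10^5 * (1 + c1\<^sup>2) * (?c * (?u + ?v))"
      using nonneg by (intro mult_mono) auto
    then show "(8100 * c1\<^sup>2 + 30247) * (?c * ?u) \<le> 10^5 * ((1 + c1\<^sup>2) * ?c) * (?u + ?v)"
      by (simp only: mult.assoc)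
  qed
  also have "\<dots> = complexity_constant c1 L \<Delta> V * (?u + ?v)"
    unfolding complexity_constant_def by (simp only: distrib_left distrib_right mult.assoc)
  finally show ?thesis .
qed

theorem corollary6p6:
  fixes n :: nat
    and fs :: "nat \<Rightarrow> 'a::euclidean_space \<Rightarrow> real"
    and \<psi> :: "'a \<Rightarrow> ereal"
    and x0 :: 'a
    and L \<sigma> V \<Delta> \<epsilon> C c1 c2 :: real
    and sgd :: "'a subroutine"
  assumes "n \<ge> 1"
    and "proper_convex \<psi>" and "prox_attained \<psi>"
    and "\<And>i. i \<in> {1..n} \<Longrightarrow> smooth L (fs i)"
    and "0 < \<sigma>" and "\<sigma> \<le> L"
    and "nonconvex \<sigma> (average n fs)"
    and "0 < V" and "variance_at_most V n fs \<psi>"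
    and "composite n fs \<psi> x0 - (INF x. composite n fs \<psi> x) \<le> ereal \<Delta>"
    and "0 < C" and "C \<le> 1"
    and "0 < c1" and "0 < c2" and "sgd3_sc C c1 c2 sgd"
    and "0 < \<epsilon>"
    and "sigma_used L V \<epsilon> \<sigma> \<le> L"
    and "epoch_length V \<epsilon> \<le> n"
  defines "M \<equiv> natasha_prune c1 sgd n fs \<psi> L (sigma_used L V \<epsilon> \<sigma>) V \<Delta> x0 \<epsilon>"
  shows "integrable (measure_pmf M)
           (\<lambda>(xout, T). norm (gradient_mapping \<psi> (average n fs) (C / L) xout)) \<and>
         measure_pmf.expectation M
           (\<lambda>(xout, T). norm (gradient_mapping \<psi> (average n fs) (C / L) xout)) \<le> \<epsilon> \<and>
         (\<forall>(xout, T) \<in> set_pmf M.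
           real T \<le> complexity_constant c1 L \<Delta> V * (1 / \<epsilon> ^ 3 + \<sigma> powr (1/3) / \<epsilon> powr (10/3)))"
proof -
  define s where "s = sigma_used L V \<epsilon> \<sigma>"
  define B where "B = epoch_length V \<epsilon>"
  define p where "p = sub_epoch_count L s B"
  define \<alpha> where "\<alpha> = learning_rate L s p"
  define T' where "T' = epoch_count (natasha_length L V \<Delta> \<epsilon> s) B"
  define T where "T = sgd_length c1 L V \<epsilon> s"
  let ?N = "natasha_full n fs \<psi> s x0 B p T' \<alpha>"
  let ?h = "\<lambda>(x, k :: nat). norm (gradient_mapping \<psi> (average n fs) (C / L) x)"
  let ?sgd = "\<lambda>y. sgd n (\<lambda>i x. fs i x + s * (norm (x - y))\<^sup>2) \<psi> y s (3 * L) T"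
  let ?G = "\<lambda>((y, z :: 'a), c). map_pmf (\<lambda>(x, c'). (x, c + c')) (?sgd y)"
  have M: "M = bind_pmf ?N ?G"
    unfolding M_def natasha_prune_def Let_def s_def B_def p_def \<alpha>_def T'_def T_def
    by (simp add: map_pmf_def split_def)
  have \<sigma>s: "\<sigma> \<le> s" and s_pos: "0 < s" and s_le: "s \<le> L" and s_large: "\<epsilon> * L / sqrt V \<le> s"
    using assms by (auto simp: s_def sigma_used_def)
  interpret K: natasha_constants L s V \<epsilon>
    using assms s_pos s_le s_large by unfold_locales
  interpret proximable \<psi> using assms by unfold_locales
  \<comment> \<open>Raising the nonconvexity parameter weakens the property, so everything below can
    run with \<open>s\<close>.\<close>
  have nonconvex_s: "nonconvex s (average n fs)"
  proof -
    have "\<sigma> / 2 * r\<^sup>2 \<le> s / 2 * r\<^sup>2" for r :: real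
      using \<sigma>s by (intro mult_right_mono) auto
    then show ?thesis
      using \<open>nonconvex \<sigma> (average n fs)\<close> unfolding nonconvex_def by (smt (verit))
  qed
  interpret natasha_parameters \<psi> n fs L s \<alpha> B p
    using assms s_pos s_le nonconvex_s K.rate_pos K.rate_le K.pieces_bounds(3) K.rate_pieces_le
      K.four_le_div K.rate_steps K.batch_pos
    unfolding \<alpha>_def p_def B_def by unfold_locales auto
  have x0: "x0 \<in> dom"
  proof (rule ccontr)
    assume "x0 \<notin> dom"
    \<comment> \<open>In \<open>ereal\<close>, \<infinity> minus anything is \<infinity>, so a
      finite bound on the gap forces the start into \<open>dom\<close>.\<close>
    then have "composite n fs \<psi> x0 = \<infinity>" by (simp add: composite_def eq_infinity)
    then show False using assms(10) by simp
  qed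
  have finite_value: "composite n fs \<psi> z = ereal (F z)" if "z \<in> dom" for z
    using that by (simp add: composite_def eq_val)
  have \<Delta>: "F x0 - \<Delta> \<le> F z" if z: "z \<in> dom" for z
  proof -
    let ?I = "INF x. composite n fs \<psi> x"
    have "?I \<le> ereal (F z)" "ereal (F x0) - ?I \<le> ereal \<Delta>"
      using assms(10) by (auto simp: finite_value[OF x0] finite_value[OF z, symmetric] intro: INF_lower)
    then show ?thesis by (cases ?I) auto
  qed
  then have \<Delta>_nonneg: "0 \<le> \<Delta>" using x0 by force
  have variance: "gradient_variance n fs x \<le> V" if "x \<in> dom" for x
    using \<open>variance_at_most V n fs \<psi>\<close> that unfolding variance_at_most_def dom_def by auto
  have T'1: "1 \<le> T'" by (simp add: T'_def epoch_count_def)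
  have T_large: "real T \<ge> 3 * L / s * ln (3 * L / s)"
    unfolding T_def by (rule K.sgd_length_sufficient)
  note subroutine = subroutine_output[OF \<open>sgd3_sc C c1 c2 sgd\<close> \<open>0 < c2\<close> \<open>0 < C\<close> \<open>C \<le> 1\<close>
      \<open>variance_at_most V n fs \<psi>\<close> _ T_large]
  \<comment> \<open>13/20 = 11/30 + 17/60 and 85/3 = 5 * 17/3. With an expected scaled residual of
    at most \<open>\<epsilon>\<^sup>2 / 100\<close> this sums to 56/60 of \<epsilon>.\<close>
  let ?k = "\<lambda>((y, z :: 'a), c :: nat). 13 / 20 * \<epsilon> + 85 / (3 * \<epsilon>) * s\<^sup>2 * residual y"
  have run: "integrable (measure_pmf (?G u)) ?h \<and> measure_pmf.expectation (?G u) ?h \<le> ?k u"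
    if "u \<in> set_pmf ?N" for u
  proof -
    obtain y z c where u: "u = ((y, z), c)" by (metis surj_pair)
    then have y: "y \<in> dom" using natasha_full_support[OF x0 T'1] that by blast
    let ?r = "s * norm (y - center y)"
    have "measure_pmf.expectation (?G u) ?h = measure_pmf.expectation (?sgd y) ?h"
      by (simp add: u split_def)
    also have "\<dots> \<le> 11 / 3 * (c1 * (sqrt V * ln (3 * L / s) powr (3/2) / sqrt (real T))) + 17 / 3 * ?r"
      by (rule subroutine(2)[OF y])
    also have "\<dots> \<le> 11 / 3 * (\<epsilon> / 10) + 17 / 3 * (\<epsilon> / 20 + 5 / \<epsilon> * (s\<^sup>2 * residual y))"
    proof (intro add_mono mult_left_mono)
      show "c1 * (sqrt V * ln (3 * L / s) powr (3/2) / sqrt (real T)) \<le> \<epsilon> / 10"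
        unfolding T_def by (rule K.sgd_error_small[OF \<open>0 < c1\<close>])
      \<comment> \<open>Only the expected square of \<open>?r\<close> is known. This tangent bound
        replaces Jensen's inequality and is sharp at \<open>?r = \<epsilon> / 10\<close>.\<close>
      have "0 \<le> (10 * ?r - \<epsilon>)\<^sup>2" by simp
      then show "?r \<le> \<epsilon> / 20 + 5 / \<epsilon> * (s\<^sup>2 * residual y)"
        using \<open>0 < \<epsilon>\<close> by (simp add: field_simps power2_eq_square)
    qed auto
    also have "\<dots> = ?k u" using \<open>0 < \<epsilon>\<close> by (simp add: u field_simps)
    finally have "measure_pmf.expectation (?G u) ?h \<le> ?k u" .
    moreover have "integrable (measure_pmf (?G u)) ?h"
      using subroutine(1)[OF y] by (simp add: u split_def)
    ultimately show ?thesis by blast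
  qed
  have fin: "finite (set_pmf ?N)" by (rule finite_natasha_full[OF x0 T'1])
  have h: "0 \<le> ?h u" for u by (simp add: split_def)
  have "integrable (measure_pmf M) ?h" and le: "measure_pmf.expectation M ?h \<le> measure_pmf.expectation ?N ?k"
    unfolding M using expectation_bind_nonneg[OF fin h, where g = ?G and k = ?k] run by auto
  have "measure_pmf.expectation ?N ?k = 13 / 20 * \<epsilon>
      + 85 / (3 * \<epsilon>) * (s\<^sup>2 * measure_pmf.expectation ?N (\<lambda>((y, z), c). residual y))"
    unfolding split_def by (subst expectation_const_add[OF fin]) simp
  also have "\<dots> \<le> 13 / 20 * \<epsilon> + 85 / (3 * \<epsilon>) * (\<epsilon>\<^sup>2 / 100)"
  proof (intro add_left_mono mult_left_mono)
    have "s\<^sup>2 * measure_pmf.expectation ?N (\<lambda>((y, z), c). residual y)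
        \<le> s\<^sup>2 * (4 / s * (\<Delta> / real (T' * p) + V / (2 * s * real B)))"
      using variance \<Delta> by (intro mult_left_mono natasha_full_expectation x0 T'1) auto
    also have "\<dots> \<le> \<epsilon>\<^sup>2 / 100"
      unfolding T'_def p_def B_def by (rule K.residual_small[OF \<Delta>_nonneg])
    finally show "s\<^sup>2 * measure_pmf.expectation ?N (\<lambda>((y, z), c). residual y) \<le> \<epsilon>\<^sup>2 / 100" .
  qed (use \<open>0 < \<epsilon>\<close> in simp)
  also have "\<dots> \<le> \<epsilon>" using \<open>0 < \<epsilon>\<close> by (simp add: power2_eq_square)
  finally have "measure_pmf.expectation M ?h \<le> \<epsilon>" using le by linarith
  moreover have "real k \<le> complexity_constant c1 L \<Delta> V * (1 / \<epsilon> ^ 3 + \<sigma> powr (1/3) / \<epsilon> powr (10/3))"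
    if xk_in: "(x, k) \<in> set_pmf M" for x k
  proof -
    obtain u where "u \<in> set_pmf ?N" and xk: "(x, k) \<in> set_pmf (?G u)"
      using xk_in unfolding M set_bind_pmf by blast
    then obtain y z c where yz: "((y, z), c) \<in> set_pmf ?N" and u: "u = ((y, z), c)"
      by (metis surj_pair)
    from xk obtain c' where c': "(x, c') \<in> set_pmf (?sgd y)" and k: "k = c + c'"
      unfolding u by auto
    have y: "y \<in> dom" and c: "c \<le> 3 * B * T'"
      using natasha_full_support[OF x0 T'1 yz] by auto
    have "c' = T"
      using subroutine_guarantee(1)[OF \<open>sgd3_sc C c1 c2 sgd\<close> \<open>0 < c2\<close>
          \<open>variance_at_most V n fs \<psi>\<close> y T_large c'] .
    then have "real k \<le> 3 * (real T' * real B) + real T"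
      using c k by (metis (no_types, opaque_lifting) add_right_mono mult.commute mult.left_commute
          of_nat_add of_nat_le_iff of_nat_mult of_nat_numeral)
    also have "\<dots> \<le> complexity_constant c1 L \<Delta> V * (1 / \<epsilon> ^ 3 + \<sigma> powr (1/3) / \<epsilon> powr (10/3))"
      unfolding T'_def T_def B_def s_def
      using L_pos \<open>0 < \<sigma>\<close> \<open>0 < V\<close> \<open>0 < \<epsilon>\<close> \<Delta>_nonneg \<open>sigma_used L V \<epsilon> \<sigma> \<le> L\<close>
      by (rule complexity_bound)
    finally show ?thesis .
  qed
  ultimately show ?thesis using \<open>integrable (measure_pmf M) ?h\<close> by auto
qed

end
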